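(* Let $m\in\mathbb{N}$, let $\alpha=\{\alpha_k\}_{k\in\mathbb{Z}}$ be a sequence of $m\times m$ matrices with complex entries such that $\|\alpha_k\|_{\mathbb{C}^{m\times m}}<1$ for all $k\in\mathbb{Z}$, and let $k_0\in\mathbb{Z}$. Let $\mathbb{U}$ be the associated full-lattice CMV operator and let $g(z,k)$, $h(z,k)$ be the entries of its Green's matrix defined in the context. Then any of the following two sets of data $(i)$ $g(z,k_0)$ and $h(z,k_0)$ for all $z$ in a sufficiently small neighborhood of the origin, under the assumption that $h(0,k_0)$ is invertible; $(ii)$ $g(z,k_0-1)$ and $g(z,k_0)$ for all $z$ in a sufficiently small neighborhood of the origin, and $\alpha_{k_0}$, under the assumption that $\alpha_{k_0}$ is invertible; uniquely determines the matrix-valued Verblunsky coefficients $\{\alpha_k\}_{k\in\mathbb{Z}}$, and hence the full-lattice CMV operator $\mathbb{U}$. (That is, two such sequences $\alpha^{(1)},\alpha^{(2)}$ satisfying the stated invertibility assumption and having the same data $(i)$, or the same data $(ii)$, coincide.)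
   Context: $\|\cdot\|_{\mathbb{C}^{m\times m}}$ is the operator norm induced by the Euclidean norm on $\mathbb{C}^m$. Given $\alpha$, set $\rho_k=(I_m-\alpha_k^*\alpha_k)^{1/2}$, $\widetilde\rho_k=(I_m-\alpha_k\alpha_k^* )^{1/2}$, and let $\Theta_k=\begin{pmatrix}-\alpha_k&\widetilde\rho_k\\ \rho_k&\alpha_k^*\end{pmatrix}$ (a unitary $2m\times2m$ matrix). On $\ell^2(\mathbb{Z})^m$ ($\mathbb{C}^m$-valued square-summable sequences) define unitary block-diagonal operators $\mathbb{V},\mathbb{W}$: $\mathbb{V}$ acts on the coordinates $(2k-1,2k)$ by $\Theta_{2k}$, and $\mathbb{W}$ acts on the coordinates $(2k,2k+1)$ by $\Theta_{2k+1}$, for all $k\in\mathbb{Z}$. The full-lattice CMV operator is the unitary operator $\mathbb{U}=\mathbb{V}\mathbb{W}$ on $\ell^2(\mathbb{Z})^m$. For $|z|<1$, $(\mathbb{U}-zI)^{-1}(k,k')\in\mathbb{C}^{m\times m}$ denotes the $(k,k')$ block of the matrix of $(\mathbb{U}-zI)^{-1}$ in the standard basis. For $k\in\mathbb{Z}$, $|z|<1$, put $$g(z,k)=(\mathbb{U}-zI)^{-1}(k,k),\qquad h(z,k)=\begin{cases}(\mathbb{U}-zI)^{-1}(k-1,k),&k\text{ odd},\\(\mathbb{U}-zI)^{-1}(k,k-1),&k\text{ even}.\end{cases}$$ *)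

theory Defs
  imports "HOL-Analysis.Analysis"
begin

subsection \<open>Matrices\<close>

definition conj_transpose :: "complex^'n^'k \<Rightarrow> complex^'k^'n" where
  "conj_transpose A = (\<chi> i j. cnj (A $ j $ i))"

definition positive_semidefinite :: "complex^'n^'n \<Rightarrow> bool" where
  "positive_semidefinite A \<longleftrightarrow>
     conj_transpose A = A \<and> (\<forall>x. 0 \<le> Re (\<Sum>i\<in>UNIV. cnj (x $ i) * (A *v x) $ i))"

definition psd_sqrt :: "complex^'n^'n \<Rightarrow> complex^'n^'n" where
  "psd_sqrt A = (THE B. positive_semidefinite B \<and> B ** B = A)"

definition block_mat ::
  "complex^'m^'m \<Rightarrow> complex^'m^'m \<Rightarrow> complex^'m^'m \<Rightarrow> complex^'m^'m
    \<Rightarrow> complex^('m + 'm)^('m + 'm)" where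
  "block_mat A B C D =
     (\<chi> i j. case i of
         Inl i' \<Rightarrow> (case j of Inl j' \<Rightarrow> A $ i' $ j' | Inr j' \<Rightarrow> B $ i' $ j')
       | Inr i' \<Rightarrow> (case j of Inl j' \<Rightarrow> C $ i' $ j' | Inr j' \<Rightarrow> D $ i' $ j'))"

definition join_vec :: "complex^'m \<Rightarrow> complex^'m \<Rightarrow> complex^('m + 'm)" where
  "join_vec x y = (\<chi> i. case i of Inl i' \<Rightarrow> x $ i' | Inr i' \<Rightarrow> y $ i')"

definition upper_part :: "complex^('m + 'm) \<Rightarrow> complex^'m" where
  "upper_part v = (\<chi> i. v $ Inl i)"

definition lower_part :: "complex^('m + 'm) \<Rightarrow> complex^'m" where
  "lower_part v = (\<chi> i. v $ Inr i)"

subsection \<open>The full-lattice CMV operator\<close>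

definition rho :: "(int \<Rightarrow> complex^'m^'m) \<Rightarrow> int \<Rightarrow> complex^'m^'m" where
  "rho \<alpha> k = psd_sqrt (mat 1 - conj_transpose (\<alpha> k) ** \<alpha> k)"

definition rho_tilde :: "(int \<Rightarrow> complex^'m^'m) \<Rightarrow> int \<Rightarrow> complex^'m^'m" where
  "rho_tilde \<alpha> k = psd_sqrt (mat 1 - \<alpha> k ** conj_transpose (\<alpha> k))"

definition Theta :: "(int \<Rightarrow> complex^'m^'m) \<Rightarrow> int \<Rightarrow> complex^('m + 'm)^('m + 'm)" where
  "Theta \<alpha> k = block_mat (- \<alpha> k) (rho_tilde \<alpha> k) (rho \<alpha> k) (conj_transpose (\<alpha> k))"

definition l2 :: "(int \<Rightarrow> complex^'m) set" where
  "l2 = {f. (\<lambda>k. (norm (f k))\<^sup>2) summable_on UNIV}"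

text \<open>
  The operators are given by their coordinate formulas, which make sense for every sequence;
  as operators on the Hilbert space they are considered on \<^term>\<open>l2\<close> only.
  In \<open>cmv_V\<close>, \<open>Theta \<alpha> n\<close> acts on the coordinates \<open>(n - 1, n)\<close> for even \<open>n\<close>;
  in \<open>cmv_W\<close>, for odd \<open>n\<close>.
\<close>

definition cmv_V ::
  "(int \<Rightarrow> complex^'m^'m) \<Rightarrow> (int \<Rightarrow> complex^'m) \<Rightarrow> (int \<Rightarrow> complex^'m)" where
  "cmv_V \<alpha> f n =
     (if even n then lower_part (Theta \<alpha> n *v join_vec (f (n - 1)) (f n))
      else upper_part (Theta \<alpha> (n + 1) *v join_vec (f n) (f (n + 1))))"

definition cmv_W ::
  "(int \<Rightarrow> complex^'m^'m) \<Rightarrow> (int \<Rightarrow> complex^'m) \<Rightarrow> (int \<Rightarrow> complex^'m)" where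
  "cmv_W \<alpha> f n =
     (if odd n then lower_part (Theta \<alpha> n *v join_vec (f (n - 1)) (f n))
      else upper_part (Theta \<alpha> (n + 1) *v join_vec (f n) (f (n + 1))))"

definition cmv_U ::
  "(int \<Rightarrow> complex^'m^'m) \<Rightarrow> (int \<Rightarrow> complex^'m) \<Rightarrow> (int \<Rightarrow> complex^'m)" where
  "cmv_U \<alpha> = cmv_V \<alpha> \<circ> cmv_W \<alpha>"

subsection \<open>The Green's matrix\<close>

text \<open>
  For \<open>\<bar>z\<bar> < 1\<close> the operator \<open>U - z I\<close> is a bijection of \<^term>\<open>l2\<close> onto itself
  whenever all \<open>\<alpha> k\<close> are strict contractions.
\<close>

definition cmv_resolvent ::
  "(int \<Rightarrow> complex^'m^'m) \<Rightarrow> complex \<Rightarrow> (int \<Rightarrow> complex^'m) \<Rightarrow> (int \<Rightarrow> complex^'m)" where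
  "cmv_resolvent \<alpha> z = inv_into l2 (\<lambda>f n. cmv_U \<alpha> f n - z *s f n)"

definition basis_seq :: "int \<Rightarrow> 'm \<Rightarrow> (int \<Rightarrow> complex^'m)" where
  "basis_seq k j = (\<lambda>n. if n = k then axis j 1 else 0)"

definition green_block ::
  "(int \<Rightarrow> complex^'m^'m) \<Rightarrow> complex \<Rightarrow> int \<Rightarrow> int \<Rightarrow> complex^'m^'m" where
  "green_block \<alpha> z k k' = (\<chi> i j. cmv_resolvent \<alpha> z (basis_seq k' j) k $ i)"

definition green_g :: "(int \<Rightarrow> complex^'m^'m) \<Rightarrow> complex \<Rightarrow> int \<Rightarrow> complex^'m^'m" where
  "green_g \<alpha> z k = green_block \<alpha> z k k"

definition green_h :: "(int \<Rightarrow> complex^'m^'m) \<Rightarrow> complex \<Rightarrow> int \<Rightarrow> complex^'m^'m" where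
  "green_h \<alpha> z k =
     (if odd k then green_block \<alpha> z (k - 1) k else green_block \<alpha> z k (k - 1))"

end

theory Submission
  imports Defs
begin

text \<open>
  Cut the lattice at \<open>k\<^sub>0\<close>. For \<open>z \<noteq> 0\<close> a bounded solution of \<open>(U - z) f = source\<close> on either half
  line is governed by a contraction (the value at \<open>z\<close> of a Schur function), and the Schur functions
  \<open>S = diag(s, t)\<close> of the two halves are tied to the \<open>2 \<times> 2\<close> block \<open>G\<close> of the Green's matrix at
  \<open>(k\<^sub>0 - 1, k\<^sub>0)\<close> by \<open>\<Theta> G = S (1 + z G)\<close> for odd \<open>k\<^sub>0\<close>, and by its transpose for even \<open>k\<^sub>0\<close>.
  Either set of data determines \<open>\<alpha> k\<^sub>0\<close> and \<open>S\<close> near \<open>0\<close>: in case (i) the relation at \<open>z = 0\<close>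
  gives \<open>\<alpha> k\<^sub>0\<close> and the remaining equations are solved for \<open>S\<close>; in case (ii) the difference of two
  solutions is bounded by a multiple of \<open>|z|\<close> times itself. Finally a Schur function determines its
  parameters, since \<open>s(z) + \<gamma>\<^sub>0\<^sup>* = O(z)\<close> and \<open>s\<close> together with \<open>\<gamma>\<^sub>0\<close> determines the Schur function
  of the shifted sequence.
\<close>

section \<open>Matrices and the operator norm\<close>

text \<open>No analyticity is used. A Schur function occurs only through its values at single points
  \<open>z \<noteq> 0\<close>, and its behaviour at the origin enters through estimates of order |z|
  that hold eventually in \<open>at 0\<close>. The origin itself is excluded because a step along a
  half line divides by z. The cut also explains the parity in \<open>green_h\<close>. For an odd
  site the block \<Theta> at the cut belongs to W, the blocks of V respect the cut, and g and h form
  a column of G. For an even site \<Theta> belongs to V, the relation becomes G \<Theta> = (1 + z G)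
  S, and g and h form a row, which is the same column after transposition. Since S is block
  diagonal, the off-diagonal blocks of S (1 + z G) have no term of order 0. In case (i) this gives
  an equation for the coefficient at the cut alone. In case (ii), where the diagonal of G is given,
  it makes the differences of the unknown off-diagonal blocks small as soon as the coefficient can
  be inverted.\<close>

abbreviation (input) opnorm :: "complex^'n^'m \<Rightarrow> real" where
  "opnorm A \<equiv> onorm ((*v) A)"

lemma matrix_vector_uminus_left [simp]: "(- A) *v x = - (A *v (x::complex^'n))"
  by (vector matrix_vector_mult_def sum_negf)

lemma matrix_vector_uminus_right [simp]: "A *v (- x) = - (A *v (x::complex^'n))"
  by (vector matrix_vector_mult_def sum_negf)

lemma mat_vector_mult: "mat z *v (x::complex^'n) = z *s x"
  by (simp add: vec_eq_iff matrix_vector_mult_def mat_def if_distrib[where f="\<lambda>c. c * _"] cong: if_cong)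

lemma scaleR_matrix_vector: "(c *\<^sub>R A) *v (x::complex^'n) = c *\<^sub>R (A *v x)"
  by (simp add: vec_eq_iff matrix_vector_mult_def scaleR_sum_right)

lemma norm_vector_smult: "norm (z *s (x::complex^'n)) = cmod z * norm x"
  by (simp add: norm_vec_def norm_mult L2_set_right_distrib)

lemma opnorm_bound: "norm (A *v x) \<le> opnorm A * norm (x::complex^'n)"
  by (rule onorm) simp

lemma opnorm_nonneg [simp]: "0 \<le> opnorm (A::complex^'n^'m)"
  by (rule onorm_pos_le) simp

lemma opnorm_le: "(\<And>x. norm (A *v x) \<le> c * norm x) \<Longrightarrow> opnorm (A::complex^'n^'m) \<le> c"
  by (rule onorm_le)

lemma opnorm_bound_le: "opnorm A \<le> c \<Longrightarrow> norm (A *v x) \<le> c * norm (x::complex^'n)"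
  by (meson opnorm_bound order_trans mult_right_mono norm_ge_zero)

lemma opnorm_le_0_imp: "opnorm (A::complex^'n^'m) \<le> 0 \<Longrightarrow> A = 0"
  using opnorm_bound_le[of A 0] by (auto simp: matrix_eq)

lemma opnorm_mult: "opnorm (A ** B) \<le> opnorm A * opnorm (B::complex^'n^'m)"
  using onorm_compose[of "(*v) A" "(*v) B"] by (simp add: o_def matrix_vector_mul_assoc)

lemma opnorm_mult_le:
  "opnorm A \<le> c \<Longrightarrow> opnorm B \<le> d \<Longrightarrow> opnorm (A ** B) \<le> c * d"
  for A :: "complex^'m^'k" and B :: "complex^'n^'m"
  by (meson opnorm_mult opnorm_nonneg order_trans mult_mono)

lemma opnorm_add: "opnorm (A + B) \<le> opnorm A + opnorm (B::complex^'n^'m)"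
proof -
  have "(*v) (A + B) = (\<lambda>x. A *v x + B *v x)"
    by (rule ext) (rule matrix_vector_mult_add_rdistrib)
  then show ?thesis
    using onorm_triangle[of "(*v) A" "(*v) B"] by simp
qed

lemma opnorm_minus [simp]: "opnorm (- A) = opnorm (A::complex^'n^'m)"
proof -
  have "(*v) (- A) = (\<lambda>x. - (A *v x))"
    by (rule ext) (rule matrix_vector_uminus_left)
  then show ?thesis
    using onorm_neg[of "(*v) A"] by simp
qed

lemma opnorm_diff: "opnorm (A - B) \<le> opnorm A + opnorm (B::complex^'n^'m)"
  using opnorm_add[of A "- B"] by simp

lemma opnorm_scaleR: "opnorm (c *\<^sub>R A) = \<bar>c\<bar> * opnorm (A::complex^'n^'m)"
proof -
  have "(*v) (c *\<^sub>R A) = (\<lambda>x. c *\<^sub>R (A *v x))"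
    by (rule ext) (rule scaleR_matrix_vector)
  then show ?thesis
    using onorm_scaleR[of "(*v) A" c] by simp
qed

lemma opnorm_mat: "opnorm (mat z :: complex^'n^'n) \<le> cmod z"
  by (rule opnorm_le) (simp add: mat_vector_mult norm_vector_smult)

lemma norm_entry_le_opnorm: "cmod (A $ i $ j) \<le> opnorm (A::complex^'n^'m)"
proof -
  have "A $ i $ j = (A *v axis j 1) $ i"
    by (simp add: matrix_vector_mult_def axis_def if_distrib cong: if_cong)
  then have "cmod (A $ i $ j) \<le> norm (A *v axis j 1)"
    by (simp add: component_le_norm_cart Finite_Cartesian_Product.norm_nth_le)
  also have "\<dots> \<le> opnorm A"
    using opnorm_bound[of A "axis j 1"] by simp
  finally show ?thesis .
qed

text \<open>Estimates are made in the operator norm, while limits of matrices are taken in the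
  Cartesian norm of the entries; this crude comparison links the two.\<close>

lemma norm_le_opnorm:
  "norm A \<le> real (CARD('m) * CARD('n)) * opnorm (A::complex^'n^'m)"
proof -
  have "norm A \<le> (\<Sum>i\<in>UNIV. norm (A $ i))"
    unfolding norm_vec_def[of A] by (rule L2_set_le_sum) simp
  also have "\<dots> \<le> (\<Sum>i\<in>(UNIV::'m set). \<Sum>j\<in>(UNIV::'n set). cmod (A $ i $ j))"
    by (rule sum_mono) (simp add: norm_vec_def L2_set_le_sum)
  also have "\<dots> \<le> (\<Sum>i\<in>(UNIV::'m set). \<Sum>j\<in>(UNIV::'n set). opnorm A)"
    by (intro sum_mono norm_entry_le_opnorm)
  finally show ?thesis by simp
qed

section \<open>Adjoint and transpose, and their operator norms\<close>

lemma conj_transpose_involutive [simp]: "conj_transpose (conj_transpose A) = A"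
  by (simp add: conj_transpose_def vec_eq_iff)

lemma conj_transpose_mult: "conj_transpose (A ** B) = conj_transpose B ** conj_transpose A"
  by (simp add: conj_transpose_def vec_eq_iff matrix_matrix_mult_def mult.commute)

lemma conj_transpose_diff: "conj_transpose (A - B) = conj_transpose A - conj_transpose B"
  by (simp add: conj_transpose_def vec_eq_iff)

lemma conj_transpose_add: "conj_transpose (A + B) = conj_transpose A + conj_transpose B"
  by (simp add: conj_transpose_def vec_eq_iff)

lemma conj_transpose_uminus [simp]: "conj_transpose (- A) = - conj_transpose A"
  by (simp add: conj_transpose_def vec_eq_iff)

lemma conj_transpose_scaleR: "conj_transpose (c *\<^sub>R A) = c *\<^sub>R conj_transpose A"
  by (simp add: conj_transpose_def vec_eq_iff)

lemma conj_transpose_one [simp]: "conj_transpose (mat 1) = mat 1"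
  by (simp add: conj_transpose_def vec_eq_iff mat_def)

lemma conj_transpose_zero [simp]: "conj_transpose 0 = 0"
  by (simp add: conj_transpose_def vec_eq_iff)

lemma conj_transpose_eq_iff [simp]: "conj_transpose A = conj_transpose B \<longleftrightarrow> A = B"
  by (metis conj_transpose_involutive)

lemma conj_transpose_transpose: "conj_transpose (transpose A) = transpose (conj_transpose A)"
  by (simp add: conj_transpose_def transpose_def vec_eq_iff)

lemma inner_complex_eq: "inner a b = Re (cnj a * b)"
  by (simp add: inner_complex_def)

lemma inner_vec_eq_Re: "inner x y = Re (\<Sum>i\<in>UNIV. cnj (x $ i) * (y $ i))" for x y :: "complex^'n"
  by (simp add: inner_vec_def inner_complex_eq)

lemma inner_matrix_vector:
  "inner (A *v x) y = inner x (conj_transpose A *v y)" for x :: "complex^'n" and y :: "complex^'m"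
proof -
  have "(\<Sum>i\<in>UNIV. cnj ((A *v x) $ i) * (y $ i))
      = (\<Sum>i\<in>UNIV. \<Sum>j\<in>UNIV. cnj (A $ i $ j) * cnj (x $ j) * y $ i)"
    by (simp add: matrix_vector_mult_def sum_distrib_right)
  also have "\<dots> = (\<Sum>j\<in>UNIV. \<Sum>i\<in>UNIV. cnj (A $ i $ j) * cnj (x $ j) * y $ i)"
    by (rule sum.swap)
  also have "\<dots> = (\<Sum>j\<in>UNIV. cnj (x $ j) * (conj_transpose A *v y) $ j)"
    by (simp add: matrix_vector_mult_def conj_transpose_def sum_distrib_left mult_ac)
  finally show ?thesis by (simp add: inner_vec_eq_Re)
qed

lemma opnorm_conj_transpose_le: "opnorm (conj_transpose A) \<le> opnorm (A::complex^'n^'m)"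
proof (rule opnorm_le)
  fix y :: "complex^'m"
  let ?w = "conj_transpose A *v y"
  have "norm ?w * norm ?w = inner ?w ?w"
    by (simp add: dot_square_norm power2_eq_square)
  also have "\<dots> = inner (A *v ?w) y"
    by (simp add: inner_matrix_vector)
  also have "\<dots> \<le> norm (A *v ?w) * norm y"
    by (rule norm_cauchy_schwarz)
  also have "\<dots> \<le> (opnorm A * norm ?w) * norm y"
    by (intro mult_right_mono opnorm_bound) simp
  finally have "norm ?w * norm ?w \<le> (opnorm A * norm y) * norm ?w" by (simp add: mult_ac)
  then show "norm ?w \<le> opnorm A * norm y"
    by (cases "?w = 0") auto
qed

lemma opnorm_conj_transpose [simp]: "opnorm (conj_transpose A) = opnorm (A::complex^'n^'m)"
  using opnorm_conj_transpose_le[of A] opnorm_conj_transpose_le[of "conj_transpose A"] by simp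

text \<open>Entrywise conjugation is an isometry that turns the transpose into the adjoint, so the
  norm of the transpose is obtained from that of the adjoint.\<close>

definition cnj_vec :: "complex^'n \<Rightarrow> complex^'n" where
  "cnj_vec x = (\<chi> i. cnj (x $ i))"

lemma norm_cnj_vec [simp]: "norm (cnj_vec x) = norm x"
  by (simp add: cnj_vec_def norm_vec_def)

lemma transpose_matrix_vector_cnj: "transpose A *v x = cnj_vec (conj_transpose A *v cnj_vec x)"
  by (simp add: vec_eq_iff cnj_vec_def matrix_vector_mult_def transpose_def conj_transpose_def)

lemma opnorm_transpose_le: "opnorm (transpose A) \<le> opnorm (A::complex^'n^'m)"
proof (rule opnorm_le)
  fix x :: "complex^'m"
  have "norm (transpose A *v x) = norm (conj_transpose A *v cnj_vec x)"
    by (simp only: transpose_matrix_vector_cnj norm_cnj_vec)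
  also have "\<dots> \<le> opnorm (conj_transpose A) * norm (cnj_vec x)"
    by (rule opnorm_bound)
  finally show "norm (transpose A *v x) \<le> opnorm A * norm x" by simp
qed

lemma opnorm_transpose [simp]: "opnorm (transpose A) = opnorm (A::complex^'n^'m)"
  using opnorm_transpose_le[of A] opnorm_transpose_le[of "transpose A"] by simp

section \<open>Matrix algebra and invertibility of small perturbations of the identity\<close>

lemma matrix_mult_minus_left [simp]: "(- A) ** B = - (A ** (B::complex^'n^'m))"
  by (simp add: vec_eq_iff matrix_matrix_mult_def sum_negf)

lemma matrix_mult_minus_right [simp]: "A ** (- B) = - (A ** (B::complex^'n^'m))"
  by (simp add: vec_eq_iff matrix_matrix_mult_def sum_negf)

lemma scaleR_matrix_mult_left: "(c *\<^sub>R A) ** B = c *\<^sub>R (A ** (B::complex^'n^'m))"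
  by (simp add: vec_eq_iff matrix_matrix_mult_def scaleR_sum_right)

lemma scaleR_matrix_mult_right: "A ** (c *\<^sub>R B) = c *\<^sub>R (A ** (B::complex^'n^'m))"
  by (simp add: vec_eq_iff matrix_matrix_mult_def scaleR_sum_right)

lemma matrix_diff_ldistrib: "A ** (B - C) = A ** B - A ** (C::complex^'n^'m)"
  by (simp add: vec_eq_iff matrix_matrix_mult_def algebra_simps sum_subtractf)

lemma matrix_diff_rdistrib: "(A - B) ** C = A ** C - B ** (C::complex^'n^'m)"
  by (simp add: vec_eq_iff matrix_matrix_mult_def algebra_simps sum_subtractf)

lemma matrix_add_rdistrib: "(A + B) ** C = A ** C + B ** (C::complex^'n^'m)"
  by (simp add: vec_eq_iff matrix_matrix_mult_def algebra_simps sum.distrib)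

lemma matrix_mult_zero [simp]: "A ** 0 = (0::complex^'n^'m)" "0 ** B = (0::complex^'k^'l)"
  by (simp_all add: vec_eq_iff matrix_matrix_mult_def)

lemma transpose_add: "transpose (A + B) = transpose A + transpose (B::complex^'n^'m)"
  by (simp add: transpose_def vec_eq_iff)

lemma transpose_diff: "transpose (A - B) = transpose A - transpose (B::complex^'n^'m)"
  by (simp add: transpose_def vec_eq_iff)

lemma mat_commute: "A ** mat z = mat z ** (A::complex^'n^'n)"
  by (simp add: matrix_eq mat_vector_mult vector_scalar_commute flip: matrix_vector_mul_assoc)

lemma opnorm_zero: "opnorm (0::complex^'n^'m) = 0"
  by (rule antisym[OF opnorm_le]) simp_all

text \<open>The form in which uniqueness is obtained later: \<open>D\<close> is the difference of
  two solutions, and \<open>x\<close> becomes less than 1 once |z| is small.\<close>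

lemma opnorm_self_bound_imp_0:
  fixes D :: "complex^'n^'m"
  assumes "opnorm D \<le> x * opnorm D" "x < 1"
  shows "D = 0"
proof (rule opnorm_le_0_imp)
  have "(1 - x) * opnorm D \<le> 0" using assms(1) by (simp add: algebra_simps)
  then show "opnorm D \<le> 0" using assms(2) by (simp add: mult_le_0_iff)
qed

lemma mat_mult_cancel:
  fixes A B :: "complex^'n^'n"
  assumes "mat z ** A = mat z ** B" "z \<noteq> 0"
  shows "A = B"
proof -
  have "A = mat (1 / z) ** (mat z ** A)" for A :: "complex^'n^'n"
    using assms(2) by (simp add: matrix_eq mat_vector_mult vector_smult_assoc flip: matrix_vector_mul_assoc)
  then show ?thesis using assms(1) by metis
qed

lemma invertible_if_ker_trivial:
  fixes A :: "complex^'n^'n"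
  assumes "\<And>x. A *v x = 0 \<Longrightarrow> x = 0"
  obtains B where "A ** B = mat 1" "B ** A = mat 1"
proof -
  have "\<exists>B. B ** A = mat 1"
    using assms by (simp add: matrix_left_invertible_ker)
  then show ?thesis
    using that matrix_left_right_inverse by blast
qed

text \<open>A kernel vector satisfies x = - A x, hence |x| is at most \<open>opnorm A\<close> times
  |x|; in finite dimension injectivity is enough.\<close>

lemma opnorm_perturb_identity:
  fixes A :: "complex^'n^'n"
  assumes "opnorm A < 1"
  obtains B where "(mat 1 + A) ** B = mat 1" "B ** (mat 1 + A) = mat 1"
proof (rule invertible_if_ker_trivial)
  fix x assume "(mat 1 + A) *v x = 0"
  then have "norm x = norm (A *v x)"
    by (metis add.inverse_unique matrix_vector_mul_lid matrix_vector_mult_add_rdistrib norm_minus_cancel)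
  also have "\<dots> \<le> opnorm A * norm x" by (rule opnorm_bound)
  finally have "(1 - opnorm A) * norm x \<le> 0" by (simp add: algebra_simps)
  with assms show "x = 0" by (simp add: mult_le_0_iff)
qed (use that in blast)

section \<open>The defect of a strict contraction\<close>

lemma tendsto_matrix_mult:
  fixes A :: "nat \<Rightarrow> complex^'n^'m" and B :: "nat \<Rightarrow> complex^'k^'n"
  assumes "A \<longlonglongrightarrow> a" "B \<longlonglongrightarrow> b"
  shows "(\<lambda>n. A n ** B n) \<longlonglongrightarrow> a ** b"
  unfolding matrix_matrix_mult_def
  by (intro vec_tendstoI) (simp, intro tendsto_intros tendsto_vec_nth assms)

lemma tendsto_matrix_vector_mult:
  fixes A :: "nat \<Rightarrow> complex^'n^'m"
  assumes "A \<longlonglongrightarrow> a"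
  shows "(\<lambda>n. A n *v x) \<longlonglongrightarrow> a *v x"
  unfolding matrix_vector_mult_def
  by (intro vec_tendstoI) (simp, intro tendsto_intros tendsto_vec_nth assms)

lemma tendsto_conj_transpose:
  fixes A :: "nat \<Rightarrow> complex^'n^'m"
  assumes "A \<longlonglongrightarrow> a"
  shows "(\<lambda>n. conj_transpose (A n)) \<longlonglongrightarrow> conj_transpose a"
  unfolding conj_transpose_def
  by (intro vec_tendstoI) (simp, intro tendsto_intros tendsto_vec_nth assms)

section \<open>Square roots by iteration\<close>

lemma convergent_if_norm_geometric:
  fixes Y :: "nat \<Rightarrow> 'a::banach"
  assumes "\<And>n. norm (Y (Suc n) - Y n) \<le> K * c ^ n" "0 \<le> c" "c < 1"
  shows "convergent Y"
proof -
  have "summable (\<lambda>n. K * c ^ n)"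
    using assms by (intro summable_mult summable_geometric) auto
  then have "summable (\<lambda>n. Y (Suc n) - Y n)"
    by (rule summable_comparison_test'[where N = 0]) (rule assms(1))
  then have "convergent (\<lambda>n. \<Sum>i<n. Y (Suc i) - Y i)"
    by (simp add: summable_iff_convergent)
  then have "convergent (\<lambda>n. Y n - Y 0)"
    by (simp add: sum_lessThan_telescope)
  then show ?thesis
    using convergent_diff_const_right_iff by blast
qed

lemma convergent_if_opnorm_geometric:
  fixes Y :: "nat \<Rightarrow> complex^'n^'m"
  assumes "\<And>n. opnorm (Y (Suc n) - Y n) \<le> c ^ n" "0 \<le> c" "c < 1"
  shows "convergent Y"
proof (rule convergent_if_norm_geometric[OF _ assms(2,3)])
  show "norm (Y (Suc n) - Y n) \<le> real (CARD('m) * CARD('n)) * c ^ n" for n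
    by (rule order_trans[OF norm_le_opnorm mult_left_mono[OF assms(1)]]) simp
qed

text \<open>
  If \<open>Y\<close> is the limit of this iteration, then \<open>(1 - Y)\<^sup>2 = 1 - X\<close>. For \<open>X = a\<^sup>* a\<close> with
  \<open>\<parallel>a\<parallel> = c < 1\<close> all iterates have norm at most \<open>c\<close>, because \<open>(c\<^sup>2 + c\<^sup>2) / 2 \<le> c\<close>.
\<close>

primrec sqrt_iter :: "complex^'n^'n \<Rightarrow> nat \<Rightarrow> complex^'n^'n" where
  "sqrt_iter X 0 = 0"
| "sqrt_iter X (Suc n) = (1/2) *\<^sub>R (X + sqrt_iter X n ** sqrt_iter X n)"

text \<open>Every iterate is a polynomial in \<open>X\<close> with fixed coefficients. The case
  \<open>X = X'\<close> gives commutation with the root; the case \<open>B = a\<close>,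
  \<open>X = a\<^sup>* a\<close>, \<open>X' = a a\<^sup>*\<close> links the two defects of
  \<open>a\<close>.\<close>

lemma sqrt_iter_intertwine:
  assumes "B ** X = X' ** B"
  shows "B ** sqrt_iter X n = sqrt_iter X' n ** B"
proof (induction n)
  case (Suc n)
  have "B ** (sqrt_iter X n ** sqrt_iter X n) = (sqrt_iter X' n ** sqrt_iter X' n) ** B"
    by (metis Suc matrix_mul_assoc)
  then show ?case
    by (simp add: scaleR_matrix_mult_left scaleR_matrix_mult_right matrix_add_ldistrib
        matrix_add_rdistrib assms)
qed simp

lemma conj_transpose_sqrt_iter:
  assumes "conj_transpose X = X"
  shows "conj_transpose (sqrt_iter X n) = sqrt_iter X n"
  by (induction n) (simp_all add: conj_transpose_scaleR conj_transpose_add conj_transpose_mult assms)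

lemma opnorm_sqrt_iter:
  assumes "opnorm X \<le> c\<^sup>2" "0 \<le> c" "c \<le> 1"
  shows "opnorm (sqrt_iter X n) \<le> c"
proof (induction n)
  case 0
  then show ?case using assms by (simp add: onorm_zero)
next
  case (Suc n)
  have "opnorm (X + sqrt_iter X n ** sqrt_iter X n) \<le> c\<^sup>2 + c * c"
    using opnorm_add[of X "sqrt_iter X n ** sqrt_iter X n"] opnorm_mult_le[OF Suc Suc] assms(1)
    by linarith
  then have "opnorm (sqrt_iter X (Suc n)) \<le> c * c"
    by (simp add: opnorm_scaleR power2_eq_square)
  also have "c * c \<le> c"
    using assms by (simp add: mult_left_le)
  finally show ?case .
qed

text \<open>With consecutive iterates Y and Z one has Z Z - Y Y = Z (Z - Y) + (Z - Y) Y. Both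
  iterates have norm at most c, and the factor 1/2 of the iteration reduces 2 c to the ratio
  c.\<close>

lemma opnorm_sqrt_iter_diff:
  assumes "opnorm X \<le> c\<^sup>2" "0 \<le> c" "c \<le> 1"
  shows "opnorm (sqrt_iter X (Suc n) - sqrt_iter X n) \<le> c ^ n"
proof (induction n)
  case 0
  have "opnorm X \<le> 1"
    using assms by (meson order_trans power_le_one)
  then show ?case
    by (simp add: opnorm_scaleR)
next
  case (Suc n)
  let ?Y = "sqrt_iter X n" and ?Z = "sqrt_iter X (Suc n)"
  have eq: "sqrt_iter X (Suc (Suc n)) - ?Z = (1/2) *\<^sub>R (?Z ** (?Z - ?Y) + (?Z - ?Y) ** ?Y)"
  proof -
    have "?Z ** (?Z - ?Y) + (?Z - ?Y) ** ?Y = ?Z ** ?Z - ?Y ** ?Y"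
      by (simp only: matrix_diff_ldistrib matrix_diff_rdistrib) simp
    moreover have "sqrt_iter X (Suc (Suc n)) - ?Z = (1/2) *\<^sub>R (?Z ** ?Z - ?Y ** ?Y)"
      by (simp only: sqrt_iter.simps(2)[of X "Suc n"] sqrt_iter.simps(2)[of X n]
          scaleR_diff_right[symmetric]) (simp only: add_diff_cancel_left)
    ultimately show ?thesis by simp
  qed
  have "opnorm (?Z ** (?Z - ?Y) + (?Z - ?Y) ** ?Y) \<le> c * c ^ n + c ^ n * c"
    using opnorm_add[of "?Z ** (?Z - ?Y)" "(?Z - ?Y) ** ?Y"]
      opnorm_mult_le[OF opnorm_sqrt_iter[OF assms, of "Suc n"] Suc]
      opnorm_mult_le[OF Suc opnorm_sqrt_iter[OF assms, of n]]
    by linarith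
  then show ?case
    unfolding eq by (simp add: opnorm_scaleR mult.commute)
qed

definition sqrt_limit :: "complex^'n^'n \<Rightarrow> complex^'n^'n" where
  "sqrt_limit X = lim (sqrt_iter X)"

lemma tendsto_sqrt_iter:
  assumes "opnorm X \<le> c\<^sup>2" "0 \<le> c" "c < 1"
  shows "sqrt_iter X \<longlonglongrightarrow> sqrt_limit X"
  unfolding sqrt_limit_def convergent_LIMSEQ_iff[symmetric]
  using assms by (intro convergent_if_opnorm_geometric[OF opnorm_sqrt_iter_diff]) auto

lemma sqrt_limit_intertwine:
  assumes "opnorm X \<le> c\<^sup>2" "opnorm X' \<le> c\<^sup>2" "0 \<le> c" "c < 1" "B ** X = X' ** B"
  shows "B ** sqrt_limit X = sqrt_limit X' ** B"
proof (rule LIMSEQ_unique)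
  show "(\<lambda>n. B ** sqrt_iter X n) \<longlonglongrightarrow> B ** sqrt_limit X"
    by (intro tendsto_matrix_mult tendsto_const tendsto_sqrt_iter[OF assms(1,3,4)])
  show "(\<lambda>n. B ** sqrt_iter X n) \<longlonglongrightarrow> sqrt_limit X' ** B"
    unfolding sqrt_iter_intertwine[OF assms(5)]
    by (intro tendsto_matrix_mult tendsto_const tendsto_sqrt_iter[OF assms(2-4)])
qed

lemma conj_transpose_sqrt_limit:
  assumes "opnorm X \<le> c\<^sup>2" "0 \<le> c" "c < 1" "conj_transpose X = X"
  shows "conj_transpose (sqrt_limit X) = sqrt_limit X"
  using tendsto_conj_transpose[OF tendsto_sqrt_iter[OF assms(1-3)]]
    tendsto_sqrt_iter[OF assms(1-3)]
  by (simp add: conj_transpose_sqrt_iter[OF assms(4)] LIMSEQ_unique)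

lemma opnorm_sqrt_limit:
  assumes "opnorm X \<le> c\<^sup>2" "0 \<le> c" "c < 1"
  shows "opnorm (sqrt_limit X) \<le> c"
proof (rule opnorm_le)
  fix x
  have "(\<lambda>n. norm (sqrt_iter X n *v x)) \<longlonglongrightarrow> norm (sqrt_limit X *v x)"
    by (intro tendsto_norm tendsto_matrix_vector_mult tendsto_sqrt_iter[OF assms])
  moreover have "norm (sqrt_iter X n *v x) \<le> c * norm x" for n
    using assms by (intro opnorm_bound_le opnorm_sqrt_iter) auto
  ultimately show "norm (sqrt_limit X *v x) \<le> c * norm x"
    by (intro LIMSEQ_le_const2) auto
qed

text \<open>The limit Y is a fixed point, 2 Y = X + Y Y, which is the expanded form of the
  claim.\<close>

lemma sqrt_limit_square:
  assumes "opnorm X \<le> c\<^sup>2" "0 \<le> c" "c < 1"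
  shows "(mat 1 - sqrt_limit X) ** (mat 1 - sqrt_limit X) = mat 1 - X"
proof -
  let ?Y = "sqrt_limit X"
  have "(\<lambda>n. sqrt_iter X (Suc n)) \<longlonglongrightarrow> (1/2) *\<^sub>R (X + ?Y ** ?Y)"
    unfolding sqrt_iter.simps
    by (intro tendsto_intros tendsto_matrix_mult tendsto_sqrt_iter[OF assms])
  then have "?Y = (1/2) *\<^sub>R (X + ?Y ** ?Y)"
    using tendsto_sqrt_iter[OF assms] LIMSEQ_unique LIMSEQ_Suc by blast
  then have "2 *\<^sub>R ?Y = 2 *\<^sub>R ((1/2) *\<^sub>R (X + ?Y ** ?Y))"
    by (rule arg_cong)
  then have "2 *\<^sub>R ?Y = X + ?Y ** ?Y" by simp
  then have "?Y + ?Y = X + ?Y ** ?Y" by (simp add: scaleR_2)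
  then show ?thesis
    by (simp add: matrix_diff_ldistrib matrix_diff_rdistrib algebra_simps)
qed

section \<open>Uniqueness of the positive root and the defect operators\<close>

lemma positive_semidefinite_iff:
  "positive_semidefinite A \<longleftrightarrow> conj_transpose A = A \<and> (\<forall>x. 0 \<le> inner x (A *v x))"
  by (simp add: positive_semidefinite_def inner_vec_eq_Re)

text \<open>Another positive root C commutes with A = C C, hence with B by \<open>comm\<close>. Then
  (C + B) (C - B) = 0, and C + B is injective because B is strictly positive. The hypothesis
  \<open>comm\<close> is met by limits of polynomials in \<open>A\<close>, so no spectral theorem is
  involved.\<close>

lemma psd_sqrt_eqI:
  assumes B: "positive_semidefinite B" "B ** B = A"
    and pos: "\<And>x. x \<noteq> 0 \<Longrightarrow> 0 < inner x (B *v x)"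
    and comm: "\<And>C. C ** A = A ** C \<Longrightarrow> C ** B = B ** C"
  shows "psd_sqrt A = B"
  unfolding psd_sqrt_def
proof (rule the_equality)
  fix C assume C: "positive_semidefinite C \<and> C ** C = A"
  then have "C ** B = B ** C"
    by (intro comm) (metis matrix_mul_assoc)
  then have *: "(C + B) ** (C - B) = 0"
    using C B by (simp add: matrix_diff_ldistrib matrix_add_rdistrib)
  obtain D where "D ** (C + B) = mat 1"
  proof (rule invertible_if_ker_trivial)
    fix x assume "(C + B) *v x = 0"
    then have "inner x (C *v x) + inner x (B *v x) = 0"
      by (metis inner_add_right inner_zero_right matrix_vector_mult_add_rdistrib)
    then show "x = 0"
      using pos[of x] C unfolding positive_semidefinite_iff by (metis add.commute add_pos_nonneg less_irrefl)
  qed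
  then have "C - B = D ** ((C + B) ** (C - B))"
    by (simp add: matrix_mul_assoc)
  then show "C = B" using * by simp
qed (use B in blast)

text \<open>The defect operator of a contraction. With \<open>a\<close> the coefficient or its
  adjoint it gives \<open>rho\<close> and \<open>rho_tilde\<close>, so each fact has to be proved
  for one of them only.\<close>

definition defect :: "complex^'n^'n \<Rightarrow> complex^'n^'n" where
  "defect a = psd_sqrt (mat 1 - conj_transpose a ** a)"

lemma opnorm_gram: "opnorm (conj_transpose a ** a) \<le> (opnorm (a::complex^'n^'n))\<^sup>2"
  using opnorm_mult[of "conj_transpose a" a] by (simp add: power2_eq_square)

lemma inner_sqrt_limit_pos:
  assumes "opnorm (a::complex^'n^'n) < 1" "x \<noteq> 0"
  shows "0 < inner x ((mat 1 - sqrt_limit (conj_transpose a ** a)) *v x)"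
proof -
  let ?Y = "sqrt_limit (conj_transpose a ** a)"
  have "opnorm ?Y \<le> opnorm a"
    using assms(1) by (intro opnorm_sqrt_limit opnorm_gram) auto
  then have "norm (?Y *v x) \<le> opnorm a * norm x"
    by (rule opnorm_bound_le)
  then have "inner x (?Y *v x) \<le> norm x * (opnorm a * norm x)"
    by (meson norm_cauchy_schwarz order_trans mult_left_mono norm_ge_zero)
  also have "\<dots> < norm x * norm x"
    using assms by simp
  finally show ?thesis
    by (simp add: matrix_vector_mult_diff_rdistrib inner_diff_right dot_square_norm power2_eq_square)
qed

lemma defect_eq_sqrt_limit:
  assumes "opnorm (a::complex^'n^'n) < 1"
  shows "defect a = mat 1 - sqrt_limit (conj_transpose a ** a)"
  unfolding defect_def
proof (rule psd_sqrt_eqI)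
  let ?X = "conj_transpose a ** a"
  have X: "opnorm ?X \<le> (opnorm a)\<^sup>2" "conj_transpose ?X = ?X"
    by (simp_all add: opnorm_gram conj_transpose_mult)
  show "positive_semidefinite (mat 1 - sqrt_limit ?X)"
    unfolding positive_semidefinite_iff
  proof (intro conjI allI)
    show "conj_transpose (mat 1 - sqrt_limit ?X) = mat 1 - sqrt_limit ?X"
      using assms X by (simp add: conj_transpose_diff conj_transpose_sqrt_limit)
    show "0 \<le> inner x ((mat 1 - sqrt_limit ?X) *v x)" for x
      using inner_sqrt_limit_pos[OF assms, of x] by (cases "x = 0") auto
  qed
  show "(mat 1 - sqrt_limit ?X) ** (mat 1 - sqrt_limit ?X) = mat 1 - ?X"
    using assms by (intro sqrt_limit_square[OF opnorm_gram]) auto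
  show "0 < inner x ((mat 1 - sqrt_limit ?X) *v x)" if "x \<noteq> 0" for x
    using that assms by (intro inner_sqrt_limit_pos) auto
  show "C ** (mat 1 - sqrt_limit ?X) = (mat 1 - sqrt_limit ?X) ** C"
    if "C ** (mat 1 - ?X) = (mat 1 - ?X) ** C" for C
  proof -
    have "C ** ?X = ?X ** C"
      using that by (simp add: matrix_diff_ldistrib matrix_diff_rdistrib)
    then have "C ** sqrt_limit ?X = sqrt_limit ?X ** C"
      using assms by (intro sqrt_limit_intertwine[OF opnorm_gram opnorm_gram]) auto
    then show ?thesis
      by (simp add: matrix_diff_ldistrib matrix_diff_rdistrib)
  qed
qed

lemma defect_uminus [simp]: "defect (- a) = defect a"
  by (simp add: defect_def)

context
  fixes a :: "complex^'n^'n"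
  assumes contr: "opnorm a < 1"
begin

lemma conj_transpose_defect [simp]: "conj_transpose (defect a) = defect a"
  using contr by (simp add: defect_eq_sqrt_limit conj_transpose_diff conj_transpose_mult
      conj_transpose_sqrt_limit[OF opnorm_gram])

lemma defect_square: "defect a ** defect a = mat 1 - conj_transpose a ** a"
  using contr by (simp add: defect_eq_sqrt_limit sqrt_limit_square[OF opnorm_gram])

lemma defect_conj_transpose_square:
  "defect (conj_transpose a) ** defect (conj_transpose a) = mat 1 - a ** conj_transpose a"
  using contr sqrt_limit_square[OF opnorm_gram[of "conj_transpose a"]]
  by (simp add: defect_eq_sqrt_limit)

lemma defect_intertwine: "a ** defect a = defect (conj_transpose a) ** a"
proof -
  have "a ** sqrt_limit (conj_transpose a ** a) = sqrt_limit (a ** conj_transpose a) ** a"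
    using contr opnorm_gram[of "conj_transpose a"]
    by (intro sqrt_limit_intertwine[OF opnorm_gram]) (auto simp: matrix_mul_assoc)
  then show ?thesis
    using contr by (simp add: defect_eq_sqrt_limit matrix_diff_ldistrib matrix_diff_rdistrib)
qed

lemma defect_ker: "defect a *v x = 0 \<Longrightarrow> x = 0"
  using inner_sqrt_limit_pos[OF contr, of x]
  unfolding defect_eq_sqrt_limit[OF contr] by fastforce

text \<open>Transposition commutes with the iteration. It exchanges the two defects, so the
  transpose of the block \<Theta> of \<open>a\<close> is the block \<Theta> of
  \<open>transpose a\<close>; even cut sites rely on this.\<close>

lemma transpose_defect: "transpose (defect a) = defect (conj_transpose (transpose a))"
proof -
  let ?a = "conj_transpose (transpose a)"
  have it: "transpose (sqrt_iter X n) = sqrt_iter (transpose X) n" for X :: "complex^'n^'n" and n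
  proof (induction n)
    case 0
    then show ?case by (simp add: transpose_def vec_eq_iff)
  next
    case (Suc n)
    have "transpose (X + sqrt_iter X n ** sqrt_iter X n)
        = transpose X + transpose (sqrt_iter X n ** sqrt_iter X n)"
      by (simp add: transpose_def vec_eq_iff)
    then show ?case by (simp add: transpose_scalar matrix_transpose_mul Suc)
  qed
  let ?X = "conj_transpose a ** a"
  have eq: "transpose ?X = conj_transpose ?a ** ?a"
    by (simp add: matrix_transpose_mul conj_transpose_transpose)
  have "(\<lambda>n. transpose (sqrt_iter ?X n)) \<longlonglongrightarrow> transpose (sqrt_limit ?X)"
    unfolding transpose_def
    by (intro vec_tendstoI) (simp, intro tendsto_vec_nth tendsto_sqrt_iter[OF opnorm_gram _ contr], simp)
  moreover have "sqrt_iter (transpose ?X) \<longlonglongrightarrow> sqrt_limit (transpose ?X)"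
    unfolding eq using contr by (intro tendsto_sqrt_iter[OF opnorm_gram]) auto
  ultimately have "transpose (sqrt_limit ?X) = sqrt_limit (transpose ?X)"
    using LIMSEQ_unique by (simp add: it)
  moreover have "transpose (mat 1 - sqrt_limit ?X) = mat 1 - transpose (sqrt_limit ?X)"
    by (simp add: transpose_def vec_eq_iff mat_def)
  ultimately show ?thesis
    using contr by (simp add: defect_eq_sqrt_limit eq)
qed

end

lemma opnorm_defect_le:
  fixes a :: "complex^'n^'n"
  assumes "opnorm a < 1"
  shows "opnorm (defect a) \<le> 1"
proof (rule opnorm_le)
  fix x
  have "(norm (defect a *v x))\<^sup>2 = inner (defect a *v x) (defect a *v x)"
    by (simp add: dot_square_norm)
  also have "\<dots> = inner x ((defect a ** defect a) *v x)"
    using assms by (simp add: inner_matrix_vector matrix_vector_mul_assoc)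
  also have "\<dots> = inner x x - inner (a *v x) (a *v x)"
    using assms by (simp add: defect_square matrix_vector_mult_diff_rdistrib inner_diff_right
        inner_matrix_vector matrix_vector_mul_assoc)
  also have "\<dots> \<le> (norm x)\<^sup>2" by (simp add: dot_square_norm)
  finally show "norm (defect a *v x) \<le> 1 * norm x"
    using power2_le_imp_le[of "norm (defect a *v x)" "norm x"] by simp
qed

section \<open>Unitarity of the block \<Theta> in coordinates\<close>

context
  fixes a :: "complex^'n^'n"
  assumes contr: "opnorm a < 1"
begin

lemma contr_conj_transpose: "opnorm (conj_transpose a) < 1"
  using contr by simp

lemma defect_identities:
  shows "defect a *v (defect a *v x) = x - conj_transpose a *v (a *v x)"
    and "defect (conj_transpose a) *v (defect (conj_transpose a) *v x) = x - a *v (conj_transpose a *v x)"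
    and "a *v (defect a *v x) = defect (conj_transpose a) *v (a *v x)"
    and "defect a *v (conj_transpose a *v x) = conj_transpose a *v (defect (conj_transpose a) *v x)"
  using defect_square[OF contr] defect_conj_transpose_square[OF contr] defect_intertwine[OF contr]
    defect_intertwine[OF contr_conj_transpose]
  by (simp_all add: matrix_vector_mul_assoc matrix_vector_mult_diff_rdistrib)

text \<open>In coordinates: (u, w) = \<Theta> (x, y) exactly if
  \<open>(x, y) = \<Theta>\<^sup>* (u, w)\<close>.\<close>

lemma theta_inverse_iff:
  "u = - (a *v x) + defect (conj_transpose a) *v y \<and> w = defect a *v x + conj_transpose a *v y \<longleftrightarrow>
   x = - (conj_transpose a *v u) + defect a *v w \<and> y = defect (conj_transpose a) *v u + a *v w"
  by (auto simp: matrix_vector_right_distrib matrix_vector_mult_diff_distrib defect_identities)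

lemma theta_norm:
  assumes "u = - (a *v x) + defect (conj_transpose a) *v y" "w = defect a *v x + conj_transpose a *v y"
  shows "(norm u)\<^sup>2 + (norm w)\<^sup>2 = (norm x)\<^sup>2 + (norm y)\<^sup>2"
proof -
  have xy: "x = - (conj_transpose a *v u) + defect a *v w" "y = defect (conj_transpose a) *v u + a *v w"
    using assms theta_inverse_iff by blast+
  have "inner u u + inner w w
      = inner u (- (a *v x) + defect (conj_transpose a) *v y) + inner w (defect a *v x + conj_transpose a *v y)"
    using assms by simp
  also have "\<dots> = inner (- (a *v x) + defect (conj_transpose a) *v y) u
      + inner (defect a *v x + conj_transpose a *v y) w"
    by (simp only: inner_commute)
  also have "\<dots> = inner x (- (conj_transpose a *v u) + defect a *v w)
      + inner y (defect (conj_transpose a) *v u + a *v w)"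
    using conj_transpose_defect[OF contr] conj_transpose_defect[OF contr_conj_transpose]
    by (simp add: inner_add_left inner_add_right inner_diff_left inner_diff_right inner_matrix_vector)
  also have "\<dots> = inner x x + inner y y"
    using xy by simp
  finally show ?thesis by (simp add: dot_square_norm)
qed

end

section \<open>The CMV operator and its resolvent\<close>

text \<open>V and W in one definition: \<open>p\<close> records whether the blocks \<Theta> act on
  pairs (n - 1, n) with even n (V) or with odd n (W). The inverse \<open>block_inv\<close> uses the
  adjoint of each block.\<close>

definition block_op :: "bool \<Rightarrow> (int \<Rightarrow> complex^'m^'m) \<Rightarrow> (int \<Rightarrow> complex^'m) \<Rightarrow> int \<Rightarrow> complex^'m" where
  "block_op p \<alpha> f n =
    (if even n = p then defect (\<alpha> n) *v f (n - 1) + conj_transpose (\<alpha> n) *v f n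
     else - (\<alpha> (n + 1) *v f n) + defect (conj_transpose (\<alpha> (n + 1))) *v f (n + 1))"

definition block_inv :: "bool \<Rightarrow> (int \<Rightarrow> complex^'m^'m) \<Rightarrow> (int \<Rightarrow> complex^'m) \<Rightarrow> int \<Rightarrow> complex^'m" where
  "block_inv p \<alpha> f n =
    (if even n = p then defect (conj_transpose (\<alpha> n)) *v f (n - 1) + \<alpha> n *v f n
     else - (conj_transpose (\<alpha> (n + 1)) *v f n) + defect (\<alpha> (n + 1)) *v f (n + 1))"

lemma sum_UNIV_Plus: "(\<Sum>i\<in>UNIV. F (i::'a::finite + 'b::finite)) = (\<Sum>i\<in>UNIV. F (Inl i)) + (\<Sum>i\<in>UNIV. F (Inr i))"
  unfolding UNIV_Plus_UNIV[symmetric] by (subst sum.Plus) auto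

lemma lower_part_block_mat:
  "lower_part (block_mat A B C D *v join_vec x y) = C *v x + D *v y"
  by (simp add: lower_part_def block_mat_def join_vec_def vec_eq_iff matrix_vector_mult_def sum_UNIV_Plus)

lemma upper_part_block_mat:
  "upper_part (block_mat A B C D *v join_vec x y) = A *v x + B *v y"
  by (simp add: upper_part_def block_mat_def join_vec_def vec_eq_iff matrix_vector_mult_def sum_UNIV_Plus)

lemma rho_eq_defect: "rho \<alpha> k = defect (\<alpha> k)" "rho_tilde \<alpha> k = defect (conj_transpose (\<alpha> k))"
  by (simp_all add: rho_def rho_tilde_def defect_def)

lemma cmv_V_eq_block_op: "cmv_V \<alpha> = block_op True \<alpha>"
  by (intro ext) (simp add: cmv_V_def block_op_def Theta_def lower_part_block_mat upper_part_block_mat rho_eq_defect)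

lemma cmv_W_eq_block_op: "cmv_W \<alpha> = block_op False \<alpha>"
  by (intro ext) (simp add: cmv_W_def block_op_def Theta_def lower_part_block_mat upper_part_block_mat rho_eq_defect)

lemma block_op_at_pair:
  assumes "even n = p"
  shows "block_op p \<alpha> f n = defect (\<alpha> n) *v f (n - 1) + conj_transpose (\<alpha> n) *v f n"
    and "block_op p \<alpha> f (n - 1) = - (\<alpha> n *v f (n - 1)) + defect (conj_transpose (\<alpha> n)) *v f n"
  using assms by (auto simp: block_op_def)

lemma block_inv_at_pair:
  assumes "even n = p"
  shows "block_inv p \<alpha> f n = defect (conj_transpose (\<alpha> n)) *v f (n - 1) + \<alpha> n *v f n"
    and "block_inv p \<alpha> f (n - 1) = - (conj_transpose (\<alpha> n) *v f (n - 1)) + defect (\<alpha> n) *v f n"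
  using assms by (auto simp: block_inv_def)

text \<open>Each site is one end of exactly one pair (n - 1, n) with n of the parity
  \<open>p\<close>, so a pointwise claim may be checked pair by pair.\<close>

lemma pair_cases:
  fixes n :: int
  assumes "\<And>n. even n = p \<Longrightarrow> P n \<and> P (n - 1)"
  shows "P n"
proof (cases "even n = p")
  case False
  then have "even (n + 1) = p" by simp
  from assms[OF this] show ?thesis by simp
qed (use assms in blast)

text \<open>The norm of \<open>f\<close> in \<open>l2\<close> is at most \<open>c\<close>, tested on
  finite sets of sites. This form carries an explicit bound and survives pointwise limits.\<close>

definition l2_bounded :: "(int \<Rightarrow> complex^'m) \<Rightarrow> real \<Rightarrow> bool" where
  "l2_bounded f c \<longleftrightarrow> (\<forall>A. finite A \<longrightarrow> L2_set (\<lambda>n. norm (f n)) A \<le> c)"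

lemma l2_boundedI: "(\<And>A. finite A \<Longrightarrow> L2_set (\<lambda>n. norm (f n)) A \<le> c) \<Longrightarrow> l2_bounded f c"
  by (simp add: l2_bounded_def)

lemma l2_boundedD: "l2_bounded f c \<Longrightarrow> finite A \<Longrightarrow> L2_set (\<lambda>n. norm (f n)) A \<le> c"
  by (simp add: l2_bounded_def)

lemma l2_bounded_nonneg: "l2_bounded f c \<Longrightarrow> 0 \<le> c"
  using l2_boundedD[of f c "{}"] by simp

lemma l2_bounded_norm_le: "l2_bounded f c \<Longrightarrow> norm (f n) \<le> c"
  using l2_boundedD[of f c "{n}"] by simp

lemma l2_bounded_mono: "l2_bounded f c \<Longrightarrow> c \<le> d \<Longrightarrow> l2_bounded f d"
  by (meson l2_bounded_def order_trans)

lemma l2_bounded_add: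
  assumes "l2_bounded f c" "l2_bounded g d"
  shows "l2_bounded (\<lambda>n. f n + g n) (c + d)"
proof (rule l2_boundedI)
  fix A :: "int set" assume A: "finite A"
  have "L2_set (\<lambda>n. norm (f n + g n)) A \<le> L2_set (\<lambda>n. norm (f n) + norm (g n)) A"
    by (intro L2_set_mono norm_triangle_ineq) auto
  also have "\<dots> \<le> L2_set (\<lambda>n. norm (f n)) A + L2_set (\<lambda>n. norm (g n)) A"
    by (rule L2_set_triangle_ineq)
  also have "\<dots> \<le> c + d"
    using assms A by (intro add_mono l2_boundedD)
  finally show "L2_set (\<lambda>n. norm (f n + g n)) A \<le> c + d" .
qed

lemma l2_bounded_smult:
  assumes "l2_bounded f c"
  shows "l2_bounded (\<lambda>n. z *s f n) (cmod z * c)"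
proof (rule l2_boundedI)
  fix A :: "int set" assume "finite A"
  then show "L2_set (\<lambda>n. norm (z *s f n)) A \<le> cmod z * c"
    using l2_boundedD[OF assms] by (simp add: norm_vector_smult mult_left_mono flip: L2_set_right_distrib)
qed

lemma l2_bounded_minus: "l2_bounded f c \<Longrightarrow> l2_bounded (\<lambda>n. - f n) c"
  by (simp add: l2_bounded_def)

lemma l2_bounded_sum:
  fixes F :: "'i \<Rightarrow> int \<Rightarrow> complex^'m"
  assumes "finite I" "\<And>i. i \<in> I \<Longrightarrow> \<exists>c. l2_bounded (F i) c"
  shows "\<exists>c. l2_bounded (\<lambda>n. \<Sum>i\<in>I. F i n) c"
  using assms
proof (induction I rule: finite_induct)
  case empty
  have "l2_bounded (\<lambda>n. 0 :: complex^'m) 0"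
    by (simp add: l2_bounded_def L2_set_def)
  then show ?case by auto
next
  case (insert i I)
  then show ?case
    by simp (metis l2_bounded_add)
qed

lemma l2_bounded_single: "l2_bounded (\<lambda>n. if n = k then v else 0) (norm v)"
proof (rule l2_boundedI)
  fix A :: "int set" assume A: "finite A"
  have "L2_set (\<lambda>n. norm (if n = k then v else 0)) A = (if k \<in> A then norm v else 0)"
    using A by (simp add: L2_set_def if_distrib[where f = norm] if_distrib[where f = "\<lambda>x. x\<^sup>2"] cong: if_cong)
  then show "L2_set (\<lambda>n. norm (if n = k then v else 0)) A \<le> norm v"
    by simp
qed

lemma l2_bounded_limit:
  assumes "\<And>j. l2_bounded (F j) c" "\<And>n. (\<lambda>j. F j n) \<longlonglongrightarrow> f n"
  shows "l2_bounded f c"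
proof (rule l2_boundedI)
  fix A :: "int set" assume A: "finite A"
  have "(\<lambda>j. L2_set (\<lambda>n. norm (F j n)) A) \<longlonglongrightarrow> L2_set (\<lambda>n. norm (f n)) A"
    unfolding L2_set_def by (intro tendsto_intros assms(2))
  then show "L2_set (\<lambda>n. norm (f n)) A \<le> c"
    using l2_boundedD[OF assms(1) A] by (intro LIMSEQ_le_const2) auto
qed

lemma l2_iff_l2_bounded: "f \<in> l2 \<longleftrightarrow> (\<exists>c. l2_bounded f c)"
proof
  assume f: "f \<in> l2"
  let ?S = "infsum (\<lambda>n. (norm (f n))\<^sup>2) UNIV"
  have "L2_set (\<lambda>n. norm (f n)) A \<le> sqrt ?S" if "finite A" for A
    unfolding L2_set_def using f that
    by (intro real_sqrt_le_mono finite_sum_le_infsum) (auto simp: l2_def)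
  then show "\<exists>c. l2_bounded f c"
    by (auto simp: l2_bounded_def)
next
  assume "\<exists>c. l2_bounded f c"
  then obtain c where c: "l2_bounded f c" by blast
  have "(\<Sum>n\<in>A. (norm (f n))\<^sup>2) \<le> c\<^sup>2" if "finite A" for A
    using l2_boundedD[OF c that] l2_bounded_nonneg[OF c]
    unfolding L2_set_def using real_le_lsqrt real_sqrt_le_iff sqrt_le_D by blast
  then have "bdd_above (sum (\<lambda>n. (norm (f n))\<^sup>2) ` {F. F \<subseteq> UNIV \<and> finite F})"
    by (intro bdd_aboveI[where M = "c\<^sup>2"]) auto
  then show "f \<in> l2"
    unfolding l2_def by (simp add: nonneg_bdd_above_summable_on)
qed

lemma sum_pairs:
  fixes F :: "int \<Rightarrow> real"
  shows "sum F {m + 1..m + 2 * int N} = (\<Sum>j<N. F (m + 2 * int j + 1) + F (m + 2 * int j + 2))"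
proof (induction N)
  case (Suc N)
  have "{m + 1..m + 2 * int (Suc N)} = insert (m + 2 * int N + 2) (insert (m + 2 * int N + 1) {m + 1..m + 2 * int N})"
    by auto
  then show ?case using Suc by simp
qed simp

text \<open>The comparison is available for complete pairs only, so a finite set of sites is first
  enlarged to an interval made of such pairs.\<close>

lemma l2_bounded_if_pairs_le:
  assumes "l2_bounded f c"
    and le: "\<And>n. even n = p \<Longrightarrow> (norm (g (n - 1)))\<^sup>2 + (norm (g n))\<^sup>2 \<le> (norm (f (n - 1)))\<^sup>2 + (norm (f n))\<^sup>2"
  shows "l2_bounded g c"
proof (rule l2_boundedI)
  fix A :: "int set" assume A: "finite A"
  define N0 where "N0 = nat (Max (insert 0 (abs ` A)))"
  \<comment> \<open>The parity of \<open>m\<close> makes the pairs (m + 2 j + 1, m + 2 j + 2) end at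
    sites of parity \<open>p\<close>; with 2 \<open>N0\<close> + 2 pairs the interval covers all
    sites of absolute value at most \<open>N0\<close>.\<close>
  define m where "m = - 2 * int N0 - (if p then 2 else 1)"
  have bd: "\<bar>n\<bar> \<le> int N0" if "n \<in> A" for n
    using A that by (simp add: N0_def)
  let ?I = "{m + 1..m + 2 * int (2 * N0 + 2)}"
  have "A \<subseteq> ?I"
  proof
    fix n assume "n \<in> A"
    from bd[OF this] show "n \<in> ?I" by (auto simp: m_def)
  qed
  have m: "even m = p" by (simp add: m_def)
  have pr: "(norm (g (m + 2 * int j + 1)))\<^sup>2 + (norm (g (m + 2 * int j + 2)))\<^sup>2
      \<le> (norm (f (m + 2 * int j + 1)))\<^sup>2 + (norm (f (m + 2 * int j + 2)))\<^sup>2" for j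
    using le[of "m + 2 * int j + 2"] m by (simp add: add.commute)
  have "L2_set (\<lambda>n. norm (g n)) A \<le> L2_set (\<lambda>n. norm (g n)) ?I"
    unfolding L2_set_def using \<open>A \<subseteq> ?I\<close> by (intro real_sqrt_le_mono sum_mono2) auto
  also have "\<dots> \<le> L2_set (\<lambda>n. norm (f n)) ?I"
    unfolding L2_set_def sum_pairs by (intro real_sqrt_le_mono sum_mono pr)
  also have "\<dots> \<le> c"
    using assms(1) by (intro l2_boundedD) auto
  finally show "L2_set (\<lambda>n. norm (g n)) A \<le> c" .
qed

section \<open>Linearity of U and its bounded inverse\<close>

lemma block_op_linear:
  "block_op p \<alpha> (\<lambda>n. f n + g n) n = block_op p \<alpha> f n + block_op p \<alpha> g n"
  "block_op p \<alpha> (\<lambda>n. f n - g n) n = block_op p \<alpha> f n - block_op p \<alpha> g n"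
  "block_op p \<alpha> (\<lambda>n. z *s f n) n = z *s block_op p \<alpha> f n"
  by (simp_all add: block_op_def algebra_simps vector_scalar_commute vector_ssub_ldistrib)

lemma block_inv_linear:
  "block_inv p \<alpha> (\<lambda>n. f n + g n) n = block_inv p \<alpha> f n + block_inv p \<alpha> g n"
  "block_inv p \<alpha> (\<lambda>n. f n - g n) n = block_inv p \<alpha> f n - block_inv p \<alpha> g n"
  "block_inv p \<alpha> (\<lambda>n. z *s f n) n = z *s block_inv p \<alpha> f n"
  by (simp_all add: block_inv_def algebra_simps vector_scalar_commute vector_ssub_ldistrib)

lemma tendsto_block_op:
  assumes "\<And>n. (\<lambda>j. F j n) \<longlonglongrightarrow> f n"
  shows "(\<lambda>j. block_op p \<alpha> (F j) n) \<longlonglongrightarrow> block_op p \<alpha> f n"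
  unfolding block_op_def
  by (auto intro!: tendsto_intros bounded_linear.tendsto[OF matrix_vector_mul_bounded_linear] assms)

definition cmv_inv :: "(int \<Rightarrow> complex^'m^'m) \<Rightarrow> (int \<Rightarrow> complex^'m) \<Rightarrow> int \<Rightarrow> complex^'m" where
  "cmv_inv \<alpha> f = block_inv False \<alpha> (block_inv True \<alpha> f)"

lemma cmv_inv_linear:
  "cmv_inv \<alpha> (\<lambda>n. f n + g n) = (\<lambda>n. cmv_inv \<alpha> f n + cmv_inv \<alpha> g n)"
  "cmv_inv \<alpha> (\<lambda>n. f n - g n) = (\<lambda>n. cmv_inv \<alpha> f n - cmv_inv \<alpha> g n)"
  "cmv_inv \<alpha> (\<lambda>n. z *s f n) = (\<lambda>n. z *s cmv_inv \<alpha> f n)"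
  unfolding cmv_inv_def block_inv_linear[abs_def] by (rule refl)+

context
  fixes \<alpha> :: "int \<Rightarrow> complex^'m^'m"
  assumes contr: "\<And>k. opnorm (\<alpha> k) < 1"
begin

lemma block_op_inv: "block_op p \<alpha> (block_inv p \<alpha> f) = f"
proof
  fix n show "block_op p \<alpha> (block_inv p \<alpha> f) n = f n"
  proof (rule pair_cases[where p = p])
    fix n :: int assume n: "even n = p"
    show "block_op p \<alpha> (block_inv p \<alpha> f) n = f n \<and> block_op p \<alpha> (block_inv p \<alpha> f) (n - 1) = f (n - 1)"
      using theta_inverse_iff[OF contr, where x = "block_inv p \<alpha> f (n - 1)" and y = "block_inv p \<alpha> f n"]
      unfolding block_op_at_pair[OF n] by (metis block_inv_at_pair[OF n])
  qed
qed

lemma block_inv_op: "block_inv p \<alpha> (block_op p \<alpha> f) = f"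
proof
  fix n show "block_inv p \<alpha> (block_op p \<alpha> f) n = f n"
  proof (rule pair_cases[where p = p])
    fix n :: int assume n: "even n = p"
    show "block_inv p \<alpha> (block_op p \<alpha> f) n = f n \<and> block_inv p \<alpha> (block_op p \<alpha> f) (n - 1) = f (n - 1)"
      using theta_inverse_iff[OF contr, where u = "block_op p \<alpha> f (n - 1)" and w = "block_op p \<alpha> f n"]
      unfolding block_inv_at_pair[OF n] by (metis block_op_at_pair[OF n])
  qed
qed

lemma block_op_norm_pair:
  assumes "even n = p"
  shows "(norm (block_op p \<alpha> f (n - 1)))\<^sup>2 + (norm (block_op p \<alpha> f n))\<^sup>2
    = (norm (f (n - 1)))\<^sup>2 + (norm (f n))\<^sup>2"
  by (rule theta_norm[OF contr[of n]]) (rule block_op_at_pair[OF assms])+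

lemma l2_bounded_block_inv: "l2_bounded f c \<Longrightarrow> l2_bounded (block_inv p \<alpha> f) c"
  by (erule l2_bounded_if_pairs_le[where p = p])
    (use block_op_norm_pair[where f = "block_inv p \<alpha> f" and p = p] in \<open>simp add: block_op_inv\<close>)

lemma l2_bounded_block_op: "l2_bounded f c \<Longrightarrow> l2_bounded (block_op p \<alpha> f) c"
  by (erule l2_bounded_if_pairs_le[where p = p])
    (use block_op_norm_pair[where f = "f" and p = p] in simp)

lemma cmv_U_inv: "cmv_U \<alpha> (cmv_inv \<alpha> f) = f"
  by (simp add: cmv_inv_def cmv_U_def cmv_V_eq_block_op cmv_W_eq_block_op block_op_inv)

lemma cmv_inv_U: "cmv_inv \<alpha> (cmv_U \<alpha> f) = f"
  by (simp add: cmv_inv_def cmv_U_def cmv_V_eq_block_op cmv_W_eq_block_op block_inv_op)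

lemma l2_bounded_cmv_inv: "l2_bounded f c \<Longrightarrow> l2_bounded (cmv_inv \<alpha> f) c"
  by (simp add: cmv_inv_def l2_bounded_block_inv)

end

lemma cmv_U_linear:
  "cmv_U \<alpha> (\<lambda>n. f n + g n) = (\<lambda>n. cmv_U \<alpha> f n + cmv_U \<alpha> g n)"
  "cmv_U \<alpha> (\<lambda>n. f n - g n) = (\<lambda>n. cmv_U \<alpha> f n - cmv_U \<alpha> g n)"
  "cmv_U \<alpha> (\<lambda>n. z *s f n) = (\<lambda>n. z *s cmv_U \<alpha> f n)"
proof -
  show "cmv_U \<alpha> (\<lambda>n. f n + g n) = (\<lambda>n. cmv_U \<alpha> f n + cmv_U \<alpha> g n)"
    by (simp add: cmv_U_def cmv_V_eq_block_op cmv_W_eq_block_op fun_eq_iff block_op_linear(1)[abs_def])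
  show "cmv_U \<alpha> (\<lambda>n. f n - g n) = (\<lambda>n. cmv_U \<alpha> f n - cmv_U \<alpha> g n)"
    by (simp add: cmv_U_def cmv_V_eq_block_op cmv_W_eq_block_op fun_eq_iff block_op_linear(2)[abs_def])
  show "cmv_U \<alpha> (\<lambda>n. z *s f n) = (\<lambda>n. z *s cmv_U \<alpha> f n)"
    by (simp add: cmv_U_def cmv_V_eq_block_op cmv_W_eq_block_op fun_eq_iff block_op_linear(3)[abs_def])
qed

section \<open>The resolvent for |z| < 1\<close>

context
  fixes \<alpha> :: "int \<Rightarrow> complex^'m^'m" and z :: complex
  assumes contr: "\<And>k. opnorm (\<alpha> k) < 1" and z: "cmod z < 1"
begin

text \<open>Neumann series: the equation (U - z) f = e is the fixed point equation for the inverse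
  of U applied to e + z f, a contraction of ratio |z|. The bound is the fixed point of x = c + |z|
  x. The iterates converge site by site, which suffices since U involves finitely many sites at a
  time.\<close>

lemma cmv_solution_exists:
  assumes e: "l2_bounded e c"
  shows "\<exists>f. (\<forall>n. cmv_U \<alpha> f n - z *s f n = e n) \<and> l2_bounded f (c / (1 - cmod z))"
proof -
  define F where "F = rec_nat (\<lambda>n. 0) (\<lambda>_ g. cmv_inv \<alpha> (\<lambda>n. e n + z *s g n))"
  have F0: "F 0 = (\<lambda>n. 0)" and FS: "F (Suc j) = cmv_inv \<alpha> (\<lambda>n. e n + z *s F j n)" for j
    by (simp_all add: F_def)
  have c0: "0 \<le> c" using e by (rule l2_bounded_nonneg)
  have zero: "l2_bounded (\<lambda>n. 0 :: complex^'m) 0"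
    by (simp add: l2_bounded_def L2_set_def)
  have bd: "l2_bounded (F j) (c / (1 - cmod z))" for j
  proof (induction j)
    case 0
    show ?case
      unfolding F0 using z c0 by (intro l2_bounded_mono[OF zero]) simp
  next
    case (Suc j)
    have "l2_bounded (F (Suc j)) (c + cmod z * (c / (1 - cmod z)))"
      unfolding FS using contr by (intro l2_bounded_cmv_inv l2_bounded_add e l2_bounded_smult Suc)
    moreover have "c + cmod z * (c / (1 - cmod z)) = c / (1 - cmod z)"
      using z by (simp add: field_simps)
    ultimately show ?case by simp
  qed
  have diff: "l2_bounded (\<lambda>n. F (Suc j) n - F j n) (c * cmod z ^ j)" for j
  proof (induction j)
    case 0
    have "l2_bounded (cmv_inv \<alpha> e) c"
      using contr e by (rule l2_bounded_cmv_inv)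
    then show ?case by (simp add: F0 FS)
  next
    case (Suc j)
    have "(\<lambda>n. F (Suc (Suc j)) n - F (Suc j) n)
        = cmv_inv \<alpha> (\<lambda>n. (e n + z *s F (Suc j) n) - (e n + z *s F j n))"
      unfolding FS[of "Suc j"] cmv_inv_linear(2) by (simp add: FS[of j])
    also have "\<dots> = (\<lambda>n. z *s cmv_inv \<alpha> (\<lambda>n. F (Suc j) n - F j n) n)"
      unfolding cmv_inv_linear(3)[symmetric] by (simp add: vector_ssub_ldistrib)
    finally have eq: "(\<lambda>n. F (Suc (Suc j)) n - F (Suc j) n)
        = (\<lambda>n. z *s cmv_inv \<alpha> (\<lambda>n. F (Suc j) n - F j n) n)" .
    have "l2_bounded (\<lambda>n. z *s cmv_inv \<alpha> (\<lambda>n. F (Suc j) n - F j n) n) (cmod z * (c * cmod z ^ j))"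
      using contr by (intro l2_bounded_smult l2_bounded_cmv_inv Suc)
    then show ?case
      unfolding eq by (simp add: mult_ac)
  qed
  have "convergent (\<lambda>j. F j n)" for n
    by (rule convergent_if_norm_geometric[where K = c and c = "cmod z"])
      (use l2_bounded_norm_le[OF diff] z in auto)
  then obtain f where f: "\<And>n. (\<lambda>j. F j n) \<longlonglongrightarrow> f n"
    unfolding convergent_def by metis
  have "cmv_U \<alpha> f n = e n + z *s f n" for n
  proof (rule LIMSEQ_unique)
    have "(\<lambda>j. cmv_U \<alpha> (F j) n) \<longlonglongrightarrow> cmv_U \<alpha> f n"
      unfolding cmv_U_def cmv_V_eq_block_op cmv_W_eq_block_op o_def
      by (intro tendsto_block_op f)
    then show "(\<lambda>j. cmv_U \<alpha> (F (Suc j)) n) \<longlonglongrightarrow> cmv_U \<alpha> f n"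
      by (rule LIMSEQ_Suc)
    have "(\<lambda>j. e n + mat z *v F j n) \<longlonglongrightarrow> e n + mat z *v f n"
      by (intro tendsto_intros bounded_linear.tendsto[OF matrix_vector_mul_bounded_linear] f)
    then show "(\<lambda>j. cmv_U \<alpha> (F (Suc j)) n) \<longlonglongrightarrow> e n + z *s f n"
      by (simp add: FS cmv_U_inv[OF contr] mat_vector_mult)
  qed
  moreover have "l2_bounded f (c / (1 - cmod z))"
    by (rule l2_bounded_limit[OF bd f])
  ultimately show ?thesis
    by (intro exI[of _ f]) simp
qed

text \<open>A solution is reproduced by z times the inverse of U, so any bound for it may be
  multiplied by |z| again and again.\<close>

lemma cmv_solution_unique_zero:
  assumes f: "l2_bounded f c" and eq: "\<And>n. cmv_U \<alpha> f n - z *s f n = 0"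
  shows "f n = 0"
proof -
  have "cmv_U \<alpha> f = (\<lambda>n. z *s f n)"
    using eq by (auto simp: fun_eq_iff)
  then have "cmv_inv \<alpha> (cmv_U \<alpha> f) = (\<lambda>n. z *s cmv_inv \<alpha> f n)"
    by (simp add: cmv_inv_linear(3))
  then have fp: "(\<lambda>n. z *s cmv_inv \<alpha> f n) = f"
    by (simp only: cmv_inv_U[OF contr])
  have "l2_bounded f (cmod z ^ j * c)" for j
  proof (induction j)
    case (Suc j)
    then have "l2_bounded (\<lambda>n. z *s cmv_inv \<alpha> f n) (cmod z * (cmod z ^ j * c))"
      using contr by (intro l2_bounded_smult l2_bounded_cmv_inv)
    then show ?case
      by (simp only: fp) (simp add: mult_ac)
  qed (use f in simp)
  then have "norm (f n) \<le> cmod z ^ j * c" for j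
    by (rule l2_bounded_norm_le)
  moreover have "(\<lambda>j. cmod z ^ j * c) \<longlonglongrightarrow> 0 * c"
    using z by (intro tendsto_intros LIMSEQ_power_zero) auto
  ultimately have "norm (f n) \<le> 0"
    by (intro LIMSEQ_le_const) auto
  then show ?thesis by simp
qed

lemma cmv_solution_unique:
  assumes "l2_bounded f c" "l2_bounded g d"
    and "\<And>n. cmv_U \<alpha> f n - z *s f n = e n" "\<And>n. cmv_U \<alpha> g n - z *s g n = e n"
  shows "f = g"
proof
  fix n
  have "l2_bounded (\<lambda>n. f n + - g n) (c + d)"
    by (intro l2_bounded_add l2_bounded_minus assms)
  then have "l2_bounded (\<lambda>n. f n - g n) (c + d)" by simp
  moreover have "cmv_U \<alpha> (\<lambda>n. f n - g n) n - z *s (f n - g n) = 0" for n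
    using assms(3)[of n] assms(4)[of n]
    by (simp add: cmv_U_linear vector_ssub_ldistrib algebra_simps)
  ultimately have "f n - g n = 0"
    by (rule cmv_solution_unique_zero)
  then show "f n = g n" by simp
qed

lemma cmv_resolvent_eq:
  assumes "l2_bounded f c" "\<And>n. cmv_U \<alpha> f n - z *s f n = e n"
  shows "cmv_resolvent \<alpha> z e = f"
proof -
  let ?T = "\<lambda>f n. cmv_U \<alpha> f n - z *s f n"
  have "inj_on ?T l2"
  proof (rule inj_onI)
    fix x y assume "x \<in> l2" "y \<in> l2" and eq: "?T x = ?T y"
    then obtain c d where "l2_bounded x c" "l2_bounded y d"
      by (auto simp: l2_iff_l2_bounded)
    then show "x = y"
      by (rule cmv_solution_unique) (use fun_cong[OF eq] in auto)
  qed
  moreover have "f \<in> l2"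
    using assms(1) by (auto simp: l2_iff_l2_bounded)
  moreover have "?T f = e"
    using assms(2) by auto
  ultimately show ?thesis
    unfolding cmv_resolvent_def using inv_into_f_f[of ?T l2 f] by simp
qed

lemma green_block_solution:
  defines "f \<equiv> \<lambda>v k' k. green_block \<alpha> z k k' *v v"
  shows "cmv_U \<alpha> (f v k') n - z *s f v k' n = (if n = k' then v else 0)"
    and "l2_bounded (f v k') (norm v / (1 - cmod z))"
proof -
  define r where "r j = cmv_resolvent \<alpha> z (basis_seq k' j)" for j
  have r: "(\<exists>c. l2_bounded (r j) c) \<and> (\<forall>n. cmv_U \<alpha> (r j) n - z *s r j n = basis_seq k' j n)" for j
  proof -
    obtain f where "\<forall>n. cmv_U \<alpha> f n - z *s f n = basis_seq k' j n"
      and "l2_bounded f (norm (axis j 1 :: complex^'m) / (1 - cmod z))"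
      using cmv_solution_exists[OF l2_bounded_single] unfolding basis_seq_def by blast
    moreover from this have "r j = f"
      unfolding r_def by (intro cmv_resolvent_eq) auto
    ultimately show ?thesis by blast
  qed
  have f_eq: "f v k' = (\<lambda>n. \<Sum>j\<in>UNIV. v $ j *s r j n)"
    by (rule ext) (simp add: f_def green_block_def matrix_vector_mult_def vec_eq_iff r_def mult.commute)
  have bd: "\<exists>c. l2_bounded (f v k') c"
    unfolding f_eq
  proof (rule l2_bounded_sum)
    fix j show "\<exists>c. l2_bounded (\<lambda>n. v $ j *s r j n) c"
      using r[of j] l2_bounded_smult by blast
  qed simp
  have lin: "cmv_U \<alpha> (\<lambda>n. \<Sum>j\<in>I. v $ j *s r j n) n - z *s (\<Sum>j\<in>I. v $ j *s r j n)
      = (\<Sum>j\<in>I. v $ j *s basis_seq k' j n)" if "finite I" for I n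
    using that
  proof (induction I arbitrary: n rule: finite_induct)
    case empty
    have "cmv_U \<alpha> (\<lambda>n. 0 *s (0::complex^'m)) n = 0 *s cmv_U \<alpha> (\<lambda>n. 0) n"
      by (simp only: cmv_U_linear(3))
    then show ?case by simp
  next
    case (insert j I)
    have "cmv_U \<alpha> (r j) n = basis_seq k' j n + z *s r j n"
      using r[of j] by (metis diff_add_cancel)
    then have "cmv_U \<alpha> (\<lambda>n. v $ j *s r j n) n = v $ j *s basis_seq k' j n + z *s (v $ j *s r j n)"
      by (simp add: cmv_U_linear vector_add_ldistrib vector_smult_assoc mult.commute)
    moreover have "cmv_U \<alpha> (\<lambda>n. \<Sum>j\<in>I. v $ j *s r j n) n
        = (\<Sum>j\<in>I. v $ j *s basis_seq k' j n) + z *s (\<Sum>j\<in>I. v $ j *s r j n)"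
      using insert.IH[of n] by (simp only: diff_eq_eq)
    ultimately show ?case
      using insert.hyps by (simp add: cmv_U_linear(1) vector_add_ldistrib)
  qed
  have src: "(\<Sum>j\<in>UNIV. v $ j *s basis_seq k' j n) = (if n = k' then v else 0)" for n
    by (simp add: basis_seq_def basis_expansion)
  show eq: "cmv_U \<alpha> (f v k') n - z *s f v k' n = (if n = k' then v else 0)" for n
    unfolding f_eq using lin[of UNIV n] src[of n] by simp
  \<comment> \<open>Combining the columns linearly yields some bound only. By uniqueness the
    combination is the Neumann solution for the source \<open>v\<close>, and it inherits the bound
    free of the dimension.\<close>
  obtain g where g: "\<forall>n. cmv_U \<alpha> g n - z *s g n = (if n = k' then v else 0)"
      "l2_bounded g (norm v / (1 - cmod z))"
    using cmv_solution_exists[OF l2_bounded_single] by blast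
  obtain c where "l2_bounded (f v k') c" using bd ..
  then have "f v k' = g"
    by (rule cmv_solution_unique[OF _ g(2)]) (use eq g(1) in auto)
  then show "l2_bounded (f v k') (norm v / (1 - cmod z))"
    using g(2) by simp
qed

lemma opnorm_green_block: "opnorm (green_block \<alpha> z k k') \<le> 1 / (1 - cmod z)"
  by (rule opnorm_le) (use l2_bounded_norm_le[OF green_block_solution(2)] in simp)

end

text \<open>The resolvent identity: G(z) v = G(0) v + z y, where y solves (U - z) y = G(0) v. At 0
  the resolvent is the inverse of U, so G(0) v has norm at most |v|.\<close>

lemma opnorm_green_block_diff:
  fixes \<alpha> :: "int \<Rightarrow> complex^'m^'m"
  assumes contr: "\<And>k. opnorm (\<alpha> k) < 1" and z: "cmod z < 1"
  shows "opnorm (green_block \<alpha> z k k' - green_block \<alpha> 0 k k') \<le> cmod z / (1 - cmod z)"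
proof (rule opnorm_le)
  fix v :: "complex^'m"
  let ?f = "\<lambda>z k. green_block \<alpha> z k k' *v v"
  have f0: "cmv_U \<alpha> (?f 0) n = (if n = k' then v else 0)" "l2_bounded (?f 0) (norm v)" for n
    using green_block_solution[of \<alpha> 0, OF contr, of k' v] by simp_all
  obtain y where y: "\<forall>n. cmv_U \<alpha> y n - z *s y n = ?f 0 n" "l2_bounded y (norm v / (1 - cmod z))"
    using cmv_solution_exists[of \<alpha>, OF contr z f0(2)] by blast
  have "?f z = (\<lambda>n. ?f 0 n + z *s y n)"
  proof (rule cmv_solution_unique[of \<alpha>, OF contr z])
    show "l2_bounded (?f z) (norm v / (1 - cmod z))"
      by (rule green_block_solution[of \<alpha>, OF contr z])
    show "l2_bounded (\<lambda>n. ?f 0 n + z *s y n) (norm v + cmod z * (norm v / (1 - cmod z)))"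
      by (intro l2_bounded_add f0 l2_bounded_smult y)
    show "cmv_U \<alpha> (?f z) n - z *s ?f z n = (if n = k' then v else 0)" for n
      by (rule green_block_solution[of \<alpha>, OF contr z])
    show "cmv_U \<alpha> (\<lambda>n. ?f 0 n + z *s y n) n - z *s (?f 0 n + z *s y n) = (if n = k' then v else 0)" for n
    proof -
      have "cmv_U \<alpha> y n = ?f 0 n + z *s y n"
        using y(1) by (simp only: diff_eq_eq)
      then show ?thesis
        using f0(1)[of n] by (simp add: cmv_U_linear)
    qed
  qed
  from fun_cong[OF this, of k]
  have "(green_block \<alpha> z k k' - green_block \<alpha> 0 k k') *v v = z *s y k"
    by (simp add: matrix_vector_mult_diff_rdistrib)
  then show "norm ((green_block \<alpha> z k k' - green_block \<alpha> 0 k k') *v v) \<le> cmod z / (1 - cmod z) * norm v"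
    using mult_left_mono[OF l2_bounded_norm_le[OF y(2), of k], of "cmod z"]
    by (simp add: norm_vector_smult)
qed

section \<open>Schur functions of half-line sequences\<close>

text \<open>
  On a half line starting at the cut, \<open>a\<close> and \<open>b\<close> alternately consist of entries of \<open>f\<close>, \<open>W f\<close> and
  \<open>z f\<close>, where \<open>f\<close> is a bounded solution of \<open>U f = z f\<close> beyond the cut. The factor \<open>z\<close>, which enters
  only at every second site, is spread evenly over all steps by rescaling with \<open>z\<^bsup>- (n div 2)\<^esup>\<close>;
  this is the origin of the growth condition.
\<close>

definition half_line ::
  "(nat \<Rightarrow> complex^'m^'m) \<Rightarrow> complex \<Rightarrow> (nat \<Rightarrow> complex^'m) \<Rightarrow> (nat \<Rightarrow> complex^'m) \<Rightarrow> bool" where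
  "half_line \<gamma> z a b \<longleftrightarrow>
    (\<forall>n. a n = - (conj_transpose (\<gamma> n) *v b n) + defect (\<gamma> n) *v (z *s a (Suc n)) \<and>
         b (Suc n) = defect (conj_transpose (\<gamma> n)) *v b n + \<gamma> n *v (z *s a (Suc n))) \<and>
    (\<exists>C. \<forall>n. cmod z ^ (n div 2) * norm (a n) \<le> C)"

text \<open>The value at z of the Schur function with parameters \<gamma>, as the map from
  \<open>b 0\<close> to \<open>a 0\<close>. Only existence of solutions is required here; that
  \<open>s\<close> governs all of them follows from contractivity.\<close>

definition schur_value :: "(nat \<Rightarrow> complex^'m^'m) \<Rightarrow> complex \<Rightarrow> complex^'m^'m \<Rightarrow> bool" where
  "schur_value \<gamma> z s \<longleftrightarrow> (\<forall>v. \<exists>a b. half_line \<gamma> z a b \<and> b 0 = v \<and> a 0 = s *v v)"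

lemma half_line_step:
  assumes "half_line \<gamma> z a b"
  shows "a n = - (conj_transpose (\<gamma> n) *v b n) + defect (\<gamma> n) *v (z *s a (Suc n))"
    and "b (Suc n) = defect (conj_transpose (\<gamma> n)) *v b n + \<gamma> n *v (z *s a (Suc n))"
  using assms unfolding half_line_def by blast+

lemma half_line_step_inverse:
  assumes "half_line \<gamma> z a b" "opnorm (\<gamma> n) < 1"
  shows "b n = - (\<gamma> n *v a n) + defect (conj_transpose (\<gamma> n)) *v b (Suc n)"
    and "z *s a (Suc n) = defect (\<gamma> n) *v a n + conj_transpose (\<gamma> n) *v b (Suc n)"
  using theta_inverse_iff[OF assms(2)] half_line_step[OF assms(1), of n] by blast+

lemma half_line_tail:
  assumes "half_line \<gamma> z a b" "z \<noteq> 0" "cmod z \<le> 1"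
  shows "half_line (\<lambda>n. \<gamma> (Suc n)) z (\<lambda>n. a (Suc n)) (\<lambda>n. b (Suc n))"
  unfolding half_line_def
proof (intro conjI allI)
  obtain C where C: "\<And>n. cmod z ^ (n div 2) * norm (a n) \<le> C"
    using assms(1) unfolding half_line_def by blast
  have "cmod z ^ (n div 2) * norm (a (Suc n)) \<le> C / cmod z" for n
  proof -
    \<comment> \<open>The exponent (n + 1) div 2 exceeds n div 2 by at most 1; the possible extra
      factor is paid for by the constant C / |z|.\<close>
    have "cmod z ^ Suc (n div 2) \<le> cmod z ^ (Suc n div 2)"
      using assms by (intro power_decreasing) auto
    then have "cmod z ^ Suc (n div 2) * norm (a (Suc n)) \<le> cmod z ^ (Suc n div 2) * norm (a (Suc n))"
      by (rule mult_right_mono) simp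
    also note C[of "Suc n"]
    finally show ?thesis
      using assms(2) by (simp add: field_simps)
  qed
  then show "\<exists>C. \<forall>n. cmod z ^ (n div 2) * norm (a (Suc n)) \<le> C" by blast
qed (rule half_line_step[OF assms(1)])+

lemma half_line_diff:
  assumes "half_line \<gamma> z a b" "half_line \<gamma> z a' b'"
  shows "half_line \<gamma> z (\<lambda>n. a n - a' n) (\<lambda>n. b n - b' n)"
  unfolding half_line_def
proof (intro conjI allI)
  fix n
  show "a n - a' n = - (conj_transpose (\<gamma> n) *v (b n - b' n)) + defect (\<gamma> n) *v (z *s (a (Suc n) - a' (Suc n)))"
    by (subst half_line_step(1)[OF assms(1), of n], subst half_line_step(1)[OF assms(2), of n])
      (simp add: vector_ssub_ldistrib matrix_vector_mult_diff_distrib)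
  show "b (Suc n) - b' (Suc n) = defect (conj_transpose (\<gamma> n)) *v (b n - b' n) + \<gamma> n *v (z *s (a (Suc n) - a' (Suc n)))"
    by (subst half_line_step(2)[OF assms(1), of n], subst half_line_step(2)[OF assms(2), of n])
      (simp add: vector_ssub_ldistrib matrix_vector_mult_diff_distrib)
next
  obtain C D where "\<And>n. cmod z ^ (n div 2) * norm (a n) \<le> C" "\<And>n. cmod z ^ (n div 2) * norm (a' n) \<le> D"
    using assms unfolding half_line_def by blast
  note CD = this
  have "cmod z ^ (n div 2) * norm (a n - a' n) \<le> C + D" for n
  proof -
    have "cmod z ^ (n div 2) * norm (a n - a' n) \<le> cmod z ^ (n div 2) * (norm (a n) + norm (a' n))"
      by (intro mult_left_mono norm_triangle_ineq4) simp
    then show ?thesis using CD[of n] by (simp add: distrib_left)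
  qed
  then show "\<exists>C. \<forall>n. cmod z ^ (n div 2) * norm (a n - a' n) \<le> C" by blast
qed

text \<open>
  Unitarity gives \<open>|b n|\<^sup>2 - |a n|\<^sup>2 = |b (n+1)|\<^sup>2 - |z|\<^sup>2 |a (n+1)|\<^sup>2 \<ge> |z|\<^sup>2 (|b (n+1)|\<^sup>2 - |a (n+1)|\<^sup>2)\<close>,
  and the growth condition makes the iterated lower bound tend to \<open>0\<close>.
\<close>

lemma half_line_contractive:
  assumes hl: "half_line \<gamma> z a b" and contr: "\<And>n. opnorm (\<gamma> n) < 1" and z: "cmod z < 1"
  shows "norm (a 0) \<le> norm (b 0)"
proof -
  let ?e = "\<lambda>n. (norm (b n))\<^sup>2 - (norm (a n))\<^sup>2"
  have step: "(cmod z)\<^sup>2 * ?e (Suc n) \<le> ?e n" for n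
  proof -
    have "(norm (b n))\<^sup>2 + (norm (z *s a (Suc n)))\<^sup>2 = (norm (a n))\<^sup>2 + (norm (b (Suc n)))\<^sup>2"
      using half_line_step_inverse[OF hl contr] by (intro theta_norm[OF contr])
    then have "?e n = (norm (b (Suc n)))\<^sup>2 - (cmod z)\<^sup>2 * (norm (a (Suc n)))\<^sup>2"
      by (simp add: norm_vector_smult power_mult_distrib)
    moreover have "(cmod z)\<^sup>2 * (norm (b (Suc n)))\<^sup>2 \<le> 1 * (norm (b (Suc n)))\<^sup>2"
      using z by (intro mult_right_mono power_le_one) auto
    ultimately show ?thesis by (simp add: algebra_simps)
  qed
  have it: "((cmod z)\<^sup>2) ^ n * ?e n \<le> ?e 0" for n
  proof (induction n)
    case (Suc n)
    have "((cmod z)\<^sup>2) ^ Suc n * ?e (Suc n) = ((cmod z)\<^sup>2) ^ n * ((cmod z)\<^sup>2 * ?e (Suc n))"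
      by simp
    also have "\<dots> \<le> ((cmod z)\<^sup>2) ^ n * ?e n"
      by (intro mult_left_mono step) simp
    also note Suc
    finally show ?case .
  qed simp
  obtain C where C: "\<And>n. cmod z ^ (n div 2) * norm (a n) \<le> C"
    using hl unfolding half_line_def by blast
  \<comment> \<open>The weight |z|^(2 n) is split: |z|^(2 (n div 2)) is absorbed by the growth
    condition, and a factor of at most |z|^n remains and tends to 0.\<close>
  have low: "- (cmod z ^ n * C\<^sup>2) \<le> ?e 0" for n
  proof -
    have "(cmod z ^ (n div 2) * norm (a n))\<^sup>2 \<le> C\<^sup>2"
      by (intro power_mono C) simp
    then have "cmod z ^ n * (cmod z ^ (2 * (n div 2)) * (norm (a n))\<^sup>2) \<le> cmod z ^ n * C\<^sup>2"
      by (intro mult_left_mono) (simp_all add: power_mult_distrib power_mult[symmetric] mult.commute)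
    moreover have "((cmod z)\<^sup>2) ^ n * (norm (a n))\<^sup>2 \<le> cmod z ^ n * (cmod z ^ (2 * (n div 2)) * (norm (a n))\<^sup>2)"
    proof -
      have "cmod z ^ (2 * n) \<le> cmod z ^ (n + 2 * (n div 2))"
        using z by (intro power_decreasing) auto
      then have "cmod z ^ (2 * n) * (norm (a n))\<^sup>2 \<le> cmod z ^ (n + 2 * (n div 2)) * (norm (a n))\<^sup>2"
        by (rule mult_right_mono) simp
      then show ?thesis
        by (simp only: power_mult[of _ 2 n] power_add mult.assoc)
    qed
    moreover have "- (((cmod z)\<^sup>2) ^ n * (norm (a n))\<^sup>2) \<le> ((cmod z)\<^sup>2) ^ n * ?e n"
      by (simp add: right_diff_distrib)
    ultimately show ?thesis using it[of n] by linarith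
  qed
  have "(\<lambda>n. - (cmod z ^ n * C\<^sup>2)) \<longlonglongrightarrow> - (0 * C\<^sup>2)"
    using z by (intro tendsto_intros LIMSEQ_power_zero) auto
  then have "- (0 * C\<^sup>2) \<le> ?e 0"
    using low by (intro LIMSEQ_le_const2) auto
  then have "(norm (a 0))\<^sup>2 \<le> (norm (b 0))\<^sup>2" by simp
  then show ?thesis
    by (rule power2_le_imp_le) simp
qed

context
  fixes \<gamma> :: "nat \<Rightarrow> complex^'m^'m" and z :: complex
  assumes contr: "\<And>n. opnorm (\<gamma> n) < 1" and z: "cmod z < 1"
begin

lemma schur_value_opnorm:
  assumes "schur_value \<gamma> z s"
  shows "opnorm s \<le> 1"
proof (rule opnorm_le)
  fix v :: "complex^'m"
  obtain a b where "half_line \<gamma> z a b" "b 0 = v" "a 0 = s *v v"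
    using assms unfolding schur_value_def by blast
  then show "norm (s *v v) \<le> 1 * norm v"
    using half_line_contractive[of \<gamma> z a b] contr z by simp
qed

text \<open>The difference of two solutions with equal \<open>b 0\<close> is again a solution, and
  contractivity forces its \<open>a 0\<close> to vanish.\<close>

lemma schur_value_half_line:
  assumes "schur_value \<gamma> z s" "half_line \<gamma> z a b"
  shows "a 0 = s *v b 0"
proof -
  obtain a' b' where ab: "half_line \<gamma> z a' b'" "b' 0 = b 0" "a' 0 = s *v b 0"
    using assms(1) unfolding schur_value_def by blast
  have "norm (a 0 - a' 0) \<le> norm (b 0 - b' 0)"
    by (rule half_line_contractive[OF half_line_diff[OF assms(2) ab(1)] contr z])
  then show ?thesis using ab by simp
qed

text \<open>The left side applied to v is the defect of \<open>\<gamma> 0\<close> applied to z a(1).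
  The tail is contractive, so |z a(1)| is at most |z| |b(1)|, and |b(1)| \<le> |v| + |b(1)| / 2
  gives the factor 2.\<close>

lemma schur_value_near_parameter:
  assumes "schur_value \<gamma> z s" "z \<noteq> 0" "cmod z \<le> 1 / 2"
  shows "opnorm (s + conj_transpose (\<gamma> 0)) \<le> 2 * cmod z"
proof (rule opnorm_le)
  fix v :: "complex^'m"
  obtain a b where ab: "half_line \<gamma> z a b" "b 0 = v" "a 0 = s *v v"
    using assms(1) unfolding schur_value_def by blast
  have "norm (a (Suc 0)) \<le> norm (b (Suc 0))"
    using half_line_contractive[OF half_line_tail[OF ab(1) assms(2)] contr] z by simp
  then have a1: "norm (z *s a (Suc 0)) \<le> cmod z * norm (b (Suc 0))"
    by (simp add: norm_vector_smult mult_left_mono)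
  also have "\<dots> \<le> 1 / 2 * norm (b (Suc 0))"
    using assms(3) by (rule mult_right_mono) simp
  finally have half: "norm (z *s a (Suc 0)) \<le> norm (b (Suc 0)) / 2" by simp
  have "norm (b (Suc 0)) \<le> norm (defect (conj_transpose (\<gamma> 0)) *v v) + norm (\<gamma> 0 *v (z *s a (Suc 0)))"
    unfolding half_line_step(2)[OF ab(1), of 0] ab(2) by (rule norm_triangle_ineq)
  also have "\<dots> \<le> 1 * norm v + 1 * norm (z *s a (Suc 0))"
    using contr[of 0] by (intro add_mono opnorm_bound_le opnorm_defect_le) auto
  finally have b1: "norm (b (Suc 0)) \<le> 2 * norm v"
    using half by simp
  have "(s + conj_transpose (\<gamma> 0)) *v v = defect (\<gamma> 0) *v (z *s a (Suc 0))"
    using half_line_step(1)[OF ab(1), of 0] ab(2,3) by (simp add: matrix_vector_mult_add_rdistrib)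
  then have "norm ((s + conj_transpose (\<gamma> 0)) *v v) \<le> 1 * norm (z *s a (Suc 0))"
    using opnorm_bound_le[OF opnorm_defect_le[OF contr[of 0]], of "z *s a (Suc 0)"] by simp
  also have "\<dots> \<le> cmod z * (2 * norm v)"
    using a1 mult_left_mono[OF b1, of "cmod z"] by simp
  finally show "norm ((s + conj_transpose (\<gamma> 0)) *v v) \<le> 2 * cmod z * norm v"
    by (simp add: mult_ac)
qed

end

text \<open>One step of the Schur algorithm, a fractional linear map. The order of quantifiers
  matters: \<open>s'\<close> depends on \<open>c\<close>, \<open>s\<close> and \<open>z\<close>
  alone, so two sequences with the same first parameter and the same value share it.\<close>

lemma schur_value_tail:
  fixes c s :: "complex^'m^'m"
  assumes c: "opnorm c < 1" and s: "opnorm s \<le> 1" and z: "z \<noteq> 0" "cmod z < 1"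
  obtains s' where
    "\<And>\<gamma>. \<gamma> 0 = c \<Longrightarrow> schur_value \<gamma> z s \<Longrightarrow> schur_value (\<lambda>n. \<gamma> (Suc n)) z s'"
proof -
  have "opnorm (c ** s) \<le> opnorm c * opnorm s" by (rule opnorm_mult)
  also have "\<dots> \<le> opnorm c * 1" using s by (intro mult_left_mono) auto
  finally have "opnorm (c ** s) < 1" using c by simp
  then obtain K where K: "(mat 1 + c ** s) ** K = mat 1"
    by (rule opnorm_perturb_identity)
  let ?r = "defect c" and ?r' = "defect (conj_transpose c)"
  define s' where "s' = mat (1 / z) ** (?r ** s ** K ** ?r' + conj_transpose c)"
  have "schur_value (\<lambda>n. \<gamma> (Suc n)) z s'" if \<gamma>: "\<gamma> 0 = c" "schur_value \<gamma> z s" for \<gamma>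
    unfolding schur_value_def
  proof
    fix v :: "complex^'m"
    \<comment> \<open>The initial value is chosen so that \<open>b 1\<close> becomes
      \<open>v\<close>: the first step reads \<open>?r' *v b 1 = (1 + c s) w\<close>, and
      \<open>?r'\<close> is injective.\<close>
    define w where "w = K *v (?r' *v v)"
    obtain a b where ab: "half_line \<gamma> z a b" "b 0 = w" "a 0 = s *v w"
      using \<gamma>(2) unfolding schur_value_def by blast
    have st: "w = - (c *v (s *v w)) + ?r' *v b (Suc 0)"
      "z *s a (Suc 0) = ?r *v (s *v w) + conj_transpose c *v b (Suc 0)"
      using half_line_step_inverse[OF ab(1), of 0] c ab(2,3) \<gamma>(1) by simp_all
    from st(1) have "?r' *v b (Suc 0) = (mat 1 + c ** s) *v w"
      by (simp add: matrix_vector_mult_add_rdistrib matrix_vector_mul_assoc algebra_simps)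
    also have "\<dots> = ?r' *v v"
      by (simp only: w_def matrix_vector_mul_assoc[of "mat 1 + c ** s" K] K matrix_vector_mul_lid)
    finally have "?r' *v (b (Suc 0) - v) = 0"
      by (simp add: matrix_vector_mult_diff_distrib)
    then have b1: "b (Suc 0) = v"
      using defect_ker[of "conj_transpose c"] c by force
    have "a (Suc 0) = (1 / z) *s (z *s a (Suc 0))"
      using z by (simp add: vector_smult_assoc)
    also have "\<dots> = s' *v v"
      unfolding st(2) b1 w_def s'_def
      by (simp add: matrix_vector_mult_add_rdistrib mat_vector_mult flip: matrix_vector_mul_assoc)
    finally show "\<exists>a b. half_line (\<lambda>n. \<gamma> (Suc n)) z a b \<and> b 0 = v \<and> a 0 = s' *v v"
      using half_line_tail[OF ab(1) z(1)] z(2) b1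
      by (intro exI[of _ "\<lambda>n. a (Suc n)"] exI[of _ "\<lambda>n. b (Suc n)"]) auto
  qed
  then show thesis using that by blast
qed

section \<open>Recovering the parameters from the Schur function\<close>

lemma opnorm_eq_0_if_eventually_le:
  fixes A :: "complex^'m^'n"
  assumes "\<forall>\<^sub>F z in at (0::complex). opnorm A \<le> c * cmod z"
  shows "A = 0"
proof (rule opnorm_le_0_imp)
  have "((\<lambda>z. c * cmod z) \<longlongrightarrow> c * cmod 0) (at 0)"
    by (intro tendsto_intros)
  then have "opnorm A \<le> c * cmod 0"
    using assms by (rule tendsto_lowerbound) simp
  then show "opnorm A \<le> 0" by simp
qed

lemma eventually_at_0_small: "0 < d \<Longrightarrow> \<forall>\<^sub>F z in at (0::complex). z \<noteq> 0 \<and> cmod z < d"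
  unfolding eventually_at by auto

lemma schur_values_determine_first_parameter:
  fixes \<gamma> \<delta> :: "nat \<Rightarrow> complex^'m^'m"
  assumes "\<And>n. opnorm (\<gamma> n) < 1" "\<And>n. opnorm (\<delta> n) < 1"
    and "\<forall>\<^sub>F z in at 0. \<exists>s. schur_value \<gamma> z s \<and> schur_value \<delta> z s"
  shows "\<gamma> 0 = \<delta> 0"
proof -
  have small: "\<forall>\<^sub>F z in at (0::complex). z \<noteq> 0 \<and> cmod z < 1 / 2"
    by (rule eventually_at_0_small) simp
  have "\<forall>\<^sub>F z in at 0. opnorm (conj_transpose (\<gamma> 0) - conj_transpose (\<delta> 0)) \<le> 4 * cmod z"
    using assms(3) small
  proof eventually_elim
    case (elim z)
    then obtain s where s: "schur_value \<gamma> z s" "schur_value \<delta> z s" by blast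
    have "opnorm (s + conj_transpose (\<gamma> 0)) \<le> 2 * cmod z" "opnorm (s + conj_transpose (\<delta> 0)) \<le> 2 * cmod z"
      using s elim assms(1,2) by (auto intro!: schur_value_near_parameter)
    moreover have "conj_transpose (\<gamma> 0) - conj_transpose (\<delta> 0)
        = (s + conj_transpose (\<gamma> 0)) - (s + conj_transpose (\<delta> 0))" by simp
    ultimately show ?case
      using opnorm_diff[of "s + conj_transpose (\<gamma> 0)" "s + conj_transpose (\<delta> 0)"] by simp
  qed
  then have "conj_transpose (\<gamma> 0) - conj_transpose (\<delta> 0) = 0"
    by (rule opnorm_eq_0_if_eventually_le)
  then show ?thesis by simp
qed

lemma schur_values_determine_parameters:
  fixes \<gamma> \<delta> :: "nat \<Rightarrow> complex^'m^'m"
  assumes "\<And>n. opnorm (\<gamma> n) < 1" "\<And>n. opnorm (\<delta> n) < 1"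
    and "\<forall>\<^sub>F z in at 0. \<exists>s. schur_value \<gamma> z s \<and> schur_value \<delta> z s"
  shows "\<gamma> n = \<delta> n"
  using assms
proof (induction n arbitrary: \<gamma> \<delta>)
  case (0 \<gamma> \<delta>)
  then show ?case by (rule schur_values_determine_first_parameter)
next
  case (Suc n \<gamma> \<delta>)
  have eq0: "\<gamma> 0 = \<delta> 0"
    using Suc.prems by (rule schur_values_determine_first_parameter)
  have small: "\<forall>\<^sub>F z in at (0::complex). z \<noteq> 0 \<and> cmod z < 1"
    by (rule eventually_at_0_small) simp
  show ?case
  proof (rule Suc.IH)
    show "\<forall>\<^sub>F z in at 0. \<exists>s. schur_value (\<lambda>n. \<gamma> (Suc n)) z s \<and> schur_value (\<lambda>n. \<delta> (Suc n)) z s"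
      using Suc.prems(3) small
    proof eventually_elim
      case (elim z)
      then obtain s where s: "schur_value \<gamma> z s" "schur_value \<delta> z s" by blast
      have "opnorm s \<le> 1"
        using s(1) elim Suc.prems by (auto intro: schur_value_opnorm)
      then obtain s' where "\<And>\<gamma>'. \<gamma>' 0 = \<gamma> 0 \<Longrightarrow> schur_value \<gamma>' z s \<Longrightarrow> schur_value (\<lambda>n. \<gamma>' (Suc n)) z s'"
        using schur_value_tail[OF Suc.prems(1)] elim by blast
      then show ?case using s eq0 by metis
    qed
  qed (use Suc.prems in auto)
qed

section \<open>Cutting the lattice\<close>

text \<open>Even steps invert one kind of block and connect \<open>k\<close> with \<open>h\<close>,
  odd steps invert the other and connect \<open>h\<close> with \<open>f\<close>. The relation
  between \<open>k\<close> and \<open>f\<close> starts at site 1, since site 0 may carry a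
  source.\<close>

lemma half_line_alternating:
  fixes f h k :: "nat \<Rightarrow> complex^'m"
  assumes z: "z \<noteq> 0"
    and e: "\<And>n. even n \<Longrightarrow> h n = - (conj_transpose (\<gamma> n) *v k n) + defect (\<gamma> n) *v k (Suc n)"
      "\<And>n. even n \<Longrightarrow> h (Suc n) = defect (conj_transpose (\<gamma> n)) *v k n + \<gamma> n *v k (Suc n)"
    and o: "\<And>n. odd n \<Longrightarrow> f n = - (conj_transpose (\<gamma> n) *v h n) + defect (\<gamma> n) *v h (Suc n)"
      "\<And>n. odd n \<Longrightarrow> f (Suc n) = defect (conj_transpose (\<gamma> n)) *v h n + \<gamma> n *v h (Suc n)"
    and k: "\<And>n. k (Suc n) = z *s f (Suc n)"
    and bd: "\<And>n. norm (f n) \<le> C" "\<And>n. norm (h n) \<le> C"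
  shows "\<exists>a b. half_line \<gamma> z a b \<and> a 0 = h 0 \<and> b 0 = k 0"
proof -
  define a where "a n = inverse z ^ (n div 2) *s (if even n then h n else f n)" for n
  define b where "b n = inverse z ^ (n div 2) *s (if even n then k n else h n)" for n
  \<comment> \<open>For even \<open>n\<close> the factor z is the one in \<open>k = z f\<close>; for
    odd \<open>n\<close> it cancels the additional inverse power of the rescaling at
    \<open>n + 1\<close>.\<close>
  have za: "z *s a (Suc n) = inverse z ^ (n div 2) *s (if even n then k (Suc n) else h (Suc n))" for n
  proof (cases "even n")
    case True
    then show ?thesis
      by (simp add: a_def k vector_smult_assoc mult.commute)
  next
    case False
    then show ?thesis
      using z by (simp add: a_def vector_smult_assoc)
  qed
  have bS: "b (Suc n) = inverse z ^ (n div 2) *s (if even n then h (Suc n) else f (Suc n))" for n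
    using z by (simp add: b_def k vector_smult_assoc)
  have "half_line \<gamma> z a b"
    unfolding half_line_def
  proof (intro conjI allI)
    fix n
    show "a n = - (conj_transpose (\<gamma> n) *v b n) + defect (\<gamma> n) *v (z *s a (Suc n))"
      unfolding za using e(1)[of n] o(1)[of n]
      by (auto simp: a_def b_def vector_scalar_commute vector_ssub_ldistrib)
    show "b (Suc n) = defect (conj_transpose (\<gamma> n)) *v b n + \<gamma> n *v (z *s a (Suc n))"
      unfolding za bS using e(2)[of n] o(2)[of n]
      by (auto simp: b_def vector_scalar_commute vector_add_ldistrib)
  next
    have "cmod z ^ (n div 2) * norm (a n) \<le> C" for n
      using z bd by (simp add: a_def norm_vector_smult norm_power norm_inverse power_inverse flip: mult.assoc)
    then show "\<exists>C. \<forall>n. cmod z ^ (n div 2) * norm (a n) \<le> C" by blast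
  qed
  then show ?thesis
    by (intro exI[of _ a] exI[of _ b]) (simp add: a_def b_def)
qed

text \<open>The block of parameter i + 1 acts on the sites i and i + 1 and has the parity
  \<open>p\<close>. The blocks of the other parity are used beyond i only, because the one ending at
  i crosses the cut.\<close>

lemma half_line_right:
  fixes f h k :: "int \<Rightarrow> complex^'m"
  assumes "z \<noteq> 0" and p: "even (i + 1) = p"
    and h: "\<And>n. n \<ge> i \<Longrightarrow> h n = block_inv p \<alpha> k n"
    and f: "\<And>n. n > i \<Longrightarrow> f n = block_inv (\<not> p) \<alpha> h n"
    and k: "\<And>n. n > i \<Longrightarrow> k n = z *s f n"
    and bd: "\<And>n. norm (f n) \<le> C" "\<And>n. norm (h n) \<le> C"
  shows "\<exists>a b. half_line (\<lambda>n. \<alpha> (i + 1 + int n)) z a b \<and> a 0 = h i \<and> b 0 = k i"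
proof -
  have "\<exists>a b. half_line (\<lambda>n. \<alpha> (i + 1 + int n)) z a b \<and> a 0 = h (i + int 0) \<and> b 0 = k (i + int 0)"
  proof (rule half_line_alternating[where f = "\<lambda>n. f (i + int n)" and C = C])
    fix n
    have idx: "i + 1 + int n - 1 = i + int n" "i + int (Suc n) = i + 1 + int n" by simp_all
    show "h (i + int n) = - (conj_transpose (\<alpha> (i + 1 + int n)) *v k (i + int n))
        + defect (\<alpha> (i + 1 + int n)) *v k (i + int (Suc n))" if "even n"
      unfolding h[of "i + int n", simplified] using block_inv_at_pair(2)[of "i + 1 + int n" p \<alpha> k] that p
      by (simp only: idx) auto
    show "h (i + int (Suc n)) = defect (conj_transpose (\<alpha> (i + 1 + int n))) *v k (i + int n)
        + \<alpha> (i + 1 + int n) *v k (i + int (Suc n))" if "even n"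
      using h[of "i + int (Suc n)"] block_inv_at_pair(1)[of "i + 1 + int n" p \<alpha> k] that p
      by (simp only: idx) auto
    show "f (i + int n) = - (conj_transpose (\<alpha> (i + 1 + int n)) *v h (i + int n))
        + defect (\<alpha> (i + 1 + int n)) *v h (i + int (Suc n))" if "odd n"
      using f[of "i + int n"] odd_pos[OF that] block_inv_at_pair(2)[of "i + 1 + int n" "\<not> p" \<alpha> h] that p
      by (simp only: idx) auto
    show "f (i + int (Suc n)) = defect (conj_transpose (\<alpha> (i + 1 + int n))) *v h (i + int n)
        + \<alpha> (i + 1 + int n) *v h (i + int (Suc n))" if "odd n"
      using f[of "i + int (Suc n)"] block_inv_at_pair(1)[of "i + 1 + int n" "\<not> p" \<alpha> h] that p
      by (simp only: idx) auto
  qed (use assms(1) k bd in auto)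
  then show ?thesis by simp
qed

text \<open>Reflecting the lattice turns the parameter \<open>\<alpha> n\<close> into \<open>- (\<alpha> n)\<^sup>*\<close>.\<close>

lemma half_line_left:
  fixes f h k :: "int \<Rightarrow> complex^'m"
  assumes "z \<noteq> 0" and p: "even i = p"
    and h: "\<And>n. n \<le> i \<Longrightarrow> h n = block_inv p \<alpha> k n"
    and f: "\<And>n. n < i \<Longrightarrow> f n = block_inv (\<not> p) \<alpha> h n"
    and k: "\<And>n. n < i \<Longrightarrow> k n = z *s f n"
    and bd: "\<And>n. norm (f n) \<le> C" "\<And>n. norm (h n) \<le> C"
  shows "\<exists>a b. half_line (\<lambda>n. - conj_transpose (\<alpha> (i - int n))) z a b \<and> a 0 = h i \<and> b 0 = k i"
proof -
  have "\<exists>a b. half_line (\<lambda>n. - conj_transpose (\<alpha> (i - int n))) z a b \<and> a 0 = h (i - int 0) \<and> b 0 = k (i - int 0)"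
  proof (rule half_line_alternating[where f = "\<lambda>n. f (i - int n)" and C = C])
    fix n
    have idx: "i - int (Suc n) = i - int n - 1" by simp
    show "h (i - int n) = - (conj_transpose (- conj_transpose (\<alpha> (i - int n))) *v k (i - int n))
        + defect (- conj_transpose (\<alpha> (i - int n))) *v k (i - int (Suc n))" if "even n"
      using h[of "i - int n"] block_inv_at_pair(1)[of "i - int n" p \<alpha> k] that p
      by (simp only: idx) auto
    show "h (i - int (Suc n)) = defect (conj_transpose (- conj_transpose (\<alpha> (i - int n)))) *v k (i - int n)
        + - conj_transpose (\<alpha> (i - int n)) *v k (i - int (Suc n))" if "even n"
      using h[of "i - int (Suc n)"] block_inv_at_pair(2)[of "i - int n" p \<alpha> k] that p
      by (simp only: idx) auto
    show "f (i - int n) = - (conj_transpose (- conj_transpose (\<alpha> (i - int n))) *v h (i - int n))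
        + defect (- conj_transpose (\<alpha> (i - int n))) *v h (i - int (Suc n))" if "odd n"
      using f[of "i - int n"] odd_pos[OF that] block_inv_at_pair(1)[of "i - int n" "\<not> p" \<alpha> h] that p
      by (simp only: idx) auto
    show "f (i - int (Suc n)) = defect (conj_transpose (- conj_transpose (\<alpha> (i - int n)))) *v h (i - int n)
        + - conj_transpose (\<alpha> (i - int n)) *v h (i - int (Suc n))" if "odd n"
      using f[of "i - int (Suc n)"] block_inv_at_pair(2)[of "i - int n" "\<not> p" \<alpha> h] that p
      by (simp only: idx) auto
  qed (use assms(1) k bd in auto)
  then show ?thesis by simp
qed

text \<open>The coefficient at \<open>k\<close> belongs to neither half: its block couples the sites
  k - 1 and k on the two sides of the cut.\<close>

definition right_params :: "(int \<Rightarrow> complex^'m^'m) \<Rightarrow> int \<Rightarrow> nat \<Rightarrow> complex^'m^'m" where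
  "right_params \<alpha> k n = \<alpha> (k + 1 + int n)"

definition left_params :: "(int \<Rightarrow> complex^'m^'m) \<Rightarrow> int \<Rightarrow> nat \<Rightarrow> complex^'m^'m" where
  "left_params \<alpha> k n = - conj_transpose (\<alpha> (k - 1 - int n))"

context
  fixes \<alpha> :: "int \<Rightarrow> complex^'m^'m" and z :: complex and k :: int and f :: "int \<Rightarrow> complex^'m"
    and v w :: "complex^'m" and c :: real
  assumes contr: "\<And>k. opnorm (\<alpha> k) < 1" and z: "z \<noteq> 0"
    and f: "l2_bounded f c"
    and eq: "\<And>n. cmv_U \<alpha> f n - z *s f n = (if n = k - 1 then v else if n = k then w else 0)"
begin

text \<open>With H = W f and K = V H = source + z f the equation splits into two relations, each of
  them local to pairs of sites.\<close>

lemma cut_solution_factors: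
  defines "H \<equiv> block_op False \<alpha> f"
    and "K \<equiv> \<lambda>n. (if n = k - 1 then v else if n = k then w else 0) + z *s f n"
  shows "H = block_inv True \<alpha> K" "f = block_inv False \<alpha> H" "K = block_op True \<alpha> H" "l2_bounded H c"
proof -
  show K: "K = block_op True \<alpha> H"
    using eq by (auto simp: K_def H_def fun_eq_iff cmv_U_def cmv_V_eq_block_op cmv_W_eq_block_op diff_eq_eq)
  show "H = block_inv True \<alpha> K"
    using contr by (simp add: K block_inv_op)
  show "f = block_inv False \<alpha> H" "l2_bounded H c"
    using contr f by (simp_all add: H_def block_inv_op l2_bounded_block_op)
qed

text \<open>The blocks of V do not join k - 1 and k, so each half starts with the step from K to H,
  and the source enters through \<open>b 0\<close>.\<close>

lemma half_lines_at_odd_cut: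
  assumes "odd k"
  shows "\<exists>a b. half_line (right_params \<alpha> k) z a b \<and>
      a 0 = block_op False \<alpha> f k \<and> b 0 = w + z *s f k"
    and "\<exists>a b. half_line (left_params \<alpha> k) z a b \<and>
      a 0 = block_op False \<alpha> f (k - 1) \<and> b 0 = v + z *s f (k - 1)"
proof -
  define H where "H = block_op False \<alpha> f"
  define K where "K n = (if n = k - 1 then v else if n = k then w else 0) + z *s f n" for n
  note fac = cut_solution_factors[folded H_def, folded K_def[abs_def]]
  have bd: "norm (f n) \<le> c" "norm (H n) \<le> c" for n
    using f fac(4) l2_bounded_norm_le by blast+
  have "\<exists>a b. half_line (\<lambda>n. \<alpha> (k + 1 + int n)) z a b \<and> a 0 = H k \<and> b 0 = K k"
  proof (rule half_line_right[where p = True and f = f and C = c])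
    show "even (k + 1) = True" using assms by simp
    show "H n = block_inv True \<alpha> K n" for n using fac(1) by (rule fun_cong)
    show "f n = block_inv (\<not> True) \<alpha> H n" for n using fun_cong[OF fac(2)] by simp
    show "K n = z *s f n" if "n > k" for n using that by (simp add: K_def)
  qed (fact z bd)+
  then show "\<exists>a b. half_line (right_params \<alpha> k) z a b \<and>
      a 0 = block_op False \<alpha> f k \<and> b 0 = w + z *s f k"
    by (simp add: right_params_def[abs_def] H_def K_def)
  have "\<exists>a b. half_line (\<lambda>n. - conj_transpose (\<alpha> (k - 1 - int n))) z a b \<and> a 0 = H (k - 1) \<and> b 0 = K (k - 1)"
  proof (rule half_line_left[where p = True and f = f and C = c])
    show "even (k - 1) = True" using assms by simp
    show "H n = block_inv True \<alpha> K n" for n using fac(1) by (rule fun_cong)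
    show "f n = block_inv (\<not> True) \<alpha> H n" for n using fun_cong[OF fac(2)] by simp
    show "K n = z *s f n" if "n < k - 1" for n using that by (simp add: K_def)
  qed (fact z bd)+
  then show "\<exists>a b. half_line (left_params \<alpha> k) z a b \<and>
      a 0 = block_op False \<alpha> f (k - 1) \<and> b 0 = v + z *s f (k - 1)"
    by (simp add: left_params_def[abs_def] H_def K_def)
qed

text \<open>Now the blocks of W respect the cut, so the first step leads from H to f and
  \<open>b 0\<close> is a value of H. In the alternating scheme \<open>f\<close> takes the place of
  \<open>h\<close>, H that of \<open>k\<close>, and H / z that of \<open>f\<close>; hence the bound
  c + c / |z|.\<close>

lemma half_lines_at_even_cut:
  assumes "even k"
  shows "\<exists>a b. half_line (right_params \<alpha> k) z a b \<and> a 0 = f k \<and> b 0 = block_op False \<alpha> f k"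
    and "\<exists>a b. half_line (left_params \<alpha> k) z a b \<and> a 0 = f (k - 1) \<and> b 0 = block_op False \<alpha> f (k - 1)"
proof -
  define H where "H = block_op False \<alpha> f"
  define K where "K n = (if n = k - 1 then v else if n = k then w else 0) + z *s f n" for n
  note fac = cut_solution_factors[folded H_def, folded K_def[abs_def]]
  have "0 \<le> c" using f by (rule l2_bounded_nonneg)
  have bd: "norm (inverse z *s H n) \<le> c + c / cmod z" "norm (f n) \<le> c + c / cmod z" for n
  proof -
    have "norm (inverse z *s H n) = norm (H n) / cmod z"
      by (simp add: norm_vector_smult norm_inverse divide_inverse mult.commute)
    also have "\<dots> \<le> c / cmod z"
      using l2_bounded_norm_le[OF fac(4)] by (intro divide_right_mono) auto
    finally show "norm (inverse z *s H n) \<le> c + c / cmod z"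
      using \<open>0 \<le> c\<close> by simp
    have "0 \<le> c / cmod z" using \<open>0 \<le> c\<close> by simp
    then show "norm (f n) \<le> c + c / cmod z"
      using l2_bounded_norm_le[OF f, of n] by linarith
  qed
  have iH: "inverse z *s H n = block_inv True \<alpha> (\<lambda>n. inverse z *s K n) n" for n
    by (simp add: block_inv_linear(3) flip: fac(1))
  have right: "inverse z *s H n = block_inv True \<alpha> f n" if "n > k" for n
  proof -
    have K: "inverse z *s K j = f j" if "j \<ge> k + 1" for j
      using that z by (simp add: K_def vector_smult_assoc)
    \<comment> \<open>The V block containing \<open>n\<close> touches no site with a source: an even
      \<open>n\<close> beyond the even \<open>k\<close> is at least k + 2.\<close>
    have "n - 1 \<ge> k + 1" if "even n" using that \<open>n > k\<close> assms by presburger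
    then show ?thesis
      unfolding iH using that by (auto simp: block_inv_def K)
  qed
  have left: "inverse z *s H n = block_inv True \<alpha> f n" if "n < k - 1" for n
  proof -
    have K: "inverse z *s K j = f j" if "j < k - 1" for j
      using that z by (simp add: K_def vector_smult_assoc)
    have "n + 1 < k - 1" if "odd n" using that \<open>n < k - 1\<close> assms by presburger
    then show ?thesis
      unfolding iH using that by (auto simp: block_inv_def K)
  qed
  have "\<exists>a b. half_line (\<lambda>n. \<alpha> (k + 1 + int n)) z a b \<and> a 0 = f k \<and> b 0 = H k"
  proof (rule half_line_right[where p = False and f = "\<lambda>n. inverse z *s H n" and C = "c + c / cmod z"])
    show "even (k + 1) = False" using assms by simp
    show "f n = block_inv False \<alpha> H n" for n using fac(2) by (rule fun_cong)
    show "inverse z *s H n = block_inv (\<not> False) \<alpha> f n" if "n > k" for n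
      using right[OF that] by simp
    show "H n = z *s (inverse z *s H n)" for n using z by (simp add: vector_smult_assoc)
  qed (fact z bd)+
  then show "\<exists>a b. half_line (right_params \<alpha> k) z a b \<and> a 0 = f k \<and> b 0 = block_op False \<alpha> f k"
    by (simp add: right_params_def[abs_def] H_def)
  have "\<exists>a b. half_line (\<lambda>n. - conj_transpose (\<alpha> (k - 1 - int n))) z a b \<and> a 0 = f (k - 1) \<and> b 0 = H (k - 1)"
  proof (rule half_line_left[where p = False and f = "\<lambda>n. inverse z *s H n" and C = "c + c / cmod z"])
    show "even (k - 1) = False" using assms by simp
    show "f n = block_inv False \<alpha> H n" for n using fac(2) by (rule fun_cong)
    show "inverse z *s H n = block_inv (\<not> False) \<alpha> f n" if "n < k - 1" for n
      using left[OF that] by simp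
    show "H n = z *s (inverse z *s H n)" for n using z by (simp add: vector_smult_assoc)
  qed (fact z bd)+
  then show "\<exists>a b. half_line (left_params \<alpha> k) z a b \<and> a 0 = f (k - 1) \<and> b 0 = block_op False \<alpha> f (k - 1)"
    by (simp add: left_params_def[abs_def] H_def)
qed

end

section \<open>Green's matrix and Schur functions at the cut\<close>

lemma green_cut_solution:
  fixes \<alpha> :: "int \<Rightarrow> complex^'m^'m" and k :: int and v w :: "complex^'m"
  assumes "\<And>k. opnorm (\<alpha> k) < 1" "cmod z < 1"
  defines "f \<equiv> \<lambda>n. green_block \<alpha> z n (k - 1) *v v + green_block \<alpha> z n k *v w"
  shows "l2_bounded f (norm v / (1 - cmod z) + norm w / (1 - cmod z))"
    and "cmv_U \<alpha> f n - z *s f n = (if n = k - 1 then v else if n = k then w else 0)"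
proof -
  note sol = green_block_solution[of \<alpha> z, OF assms(1,2)]
  show "l2_bounded f (norm v / (1 - cmod z) + norm w / (1 - cmod z))"
    unfolding f_def by (intro l2_bounded_add sol)
  have "cmv_U \<alpha> f n - z *s f n
      = (cmv_U \<alpha> (\<lambda>n. green_block \<alpha> z n (k - 1) *v v) n - z *s (green_block \<alpha> z n (k - 1) *v v))
      + (cmv_U \<alpha> (\<lambda>n. green_block \<alpha> z n k *v w) n - z *s (green_block \<alpha> z n k *v w))"
    unfolding f_def cmv_U_linear(1) by (simp add: vector_add_ldistrib)
  also have "\<dots> = (if n = k - 1 then v else if n = k then w else 0)"
    unfolding sol by simp
  finally show "cmv_U \<alpha> f n - z *s f n = (if n = k - 1 then v else if n = k then w else 0)" .
qed

lemma opnorm_mat_mult_green: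
  assumes "\<And>k. opnorm (\<alpha> k) < 1" "cmod z < 1 / 2"
  shows "opnorm (mat z ** green_block \<alpha> z k k') < 1"
proof -
  have "opnorm (mat z ** green_block \<alpha> z k k') \<le> cmod z * (1 / (1 - cmod z))"
    using assms by (intro opnorm_mult_le opnorm_mat opnorm_green_block) auto
  also have "\<dots> < 1" using assms(2) by (simp add: field_simps)
  finally show ?thesis .
qed

text \<open>
  The half line is embedded into a full lattice with an arbitrary left half. A source at the first
  site of the half line then produces every initial value \<open>b 0\<close>, because \<open>1 + z g(z)\<close> is invertible
  for small \<open>z\<close>.
\<close>

lemma schur_value_exists:
  fixes \<gamma> :: "nat \<Rightarrow> complex^'m^'m"
  assumes \<gamma>: "\<And>n. opnorm (\<gamma> n) < 1" and z: "z \<noteq> 0" "cmod z < 1 / 2"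
  shows "\<exists>s. schur_value \<gamma> z s"
proof -
  \<comment> \<open>The cut is placed at the odd site 1, so its right half starts at index 2; zeros
    elsewhere are strict contractions.\<close>
  define \<alpha> where "\<alpha> i = (if i \<ge> 2 then \<gamma> (nat (i - 2)) else 0)" for i
  have contr: "opnorm (\<alpha> i) < 1" for i
    using \<gamma> by (simp add: \<alpha>_def opnorm_zero)
  have R: "right_params \<alpha> 1 = \<gamma>"
    by (simp add: right_params_def \<alpha>_def fun_eq_iff)
  let ?G = "green_block \<alpha> z"
  obtain B where B: "(mat 1 + mat z ** ?G 1 1) ** B = mat 1"
    using opnorm_perturb_identity[OF opnorm_mat_mult_green[of \<alpha>, OF contr z(2)]] by blast
  have "schur_value \<gamma> z ((defect (\<alpha> 1) ** ?G 0 1 + conj_transpose (\<alpha> 1) ** ?G 1 1) ** B)"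
    unfolding schur_value_def
  proof
    fix v :: "complex^'m"
    let ?w = "B *v v"
    let ?f = "\<lambda>n. ?G n (1 - 1) *v 0 + ?G n 1 *v ?w"
    have z1: "cmod z < 1" using z(2) by simp
    obtain a b where ab: "half_line (right_params \<alpha> 1) z a b"
      "a 0 = block_op False \<alpha> ?f 1" "b 0 = ?w + z *s ?f 1"
      using half_lines_at_odd_cut(1)[of \<alpha>, OF contr z(1)
          green_cut_solution[of \<alpha> z, OF contr z1, of 1 0 ?w] odd_one] by blast
    have "b 0 = (mat 1 + mat z ** ?G 1 1) *v ?w"
      by (simp add: ab(3) matrix_vector_mult_add_rdistrib mat_vector_mult flip: matrix_vector_mul_assoc)
    also have "\<dots> = v"
      by (simp only: matrix_vector_mul_assoc B matrix_vector_mul_lid)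
    finally have "b 0 = v" .
    moreover have "a 0 = ((defect (\<alpha> 1) ** ?G 0 1 + conj_transpose (\<alpha> 1) ** ?G 1 1) ** B) *v v"
      by (simp add: ab(2) block_op_def matrix_vector_mult_add_rdistrib flip: matrix_vector_mul_assoc)
    ultimately show "\<exists>a b. half_line \<gamma> z a b \<and> b 0 = v \<and>
        a 0 = ((defect (\<alpha> 1) ** ?G 0 1 + conj_transpose (\<alpha> 1) ** ?G 1 1) ** B) *v v"
      using ab(1) unfolding R by blast
  qed
  then show ?thesis ..
qed

text \<open>
  In block form, with \<open>G = (p, h; q, g)\<close> and \<open>S = diag(s, t)\<close>, this says \<open>\<Theta> G = S (1 + z G)\<close>.
\<close>

definition cut_relation ::
  "complex^'m^'m \<Rightarrow> complex \<Rightarrow> complex^'m^'m \<Rightarrow> complex^'m^'m \<Rightarrow>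
   complex^'m^'m \<Rightarrow> complex^'m^'m \<Rightarrow> complex^'m^'m \<Rightarrow> complex^'m^'m \<Rightarrow> bool" where
  "cut_relation a z s t p h q g \<longleftrightarrow>
    defect (conj_transpose a) ** q - a ** p = s + mat z ** (s ** p) \<and>
    defect (conj_transpose a) ** g - a ** h = mat z ** (s ** h) \<and>
    defect a ** p + conj_transpose a ** q = mat z ** (t ** q) \<and>
    defect a ** h + conj_transpose a ** g = t + mat z ** (t ** g)"

lemma contr_params:
  assumes "\<And>k. opnorm (\<alpha> k) < 1"
  shows "opnorm (right_params \<alpha> k n) < 1" "opnorm (left_params \<alpha> k n) < 1"
  using assms by (simp_all add: right_params_def left_params_def)

context
  fixes \<alpha> :: "int \<Rightarrow> complex^'m^'m" and z :: complex and k :: int and s t :: "complex^'m^'m"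
  assumes contr: "\<And>k. opnorm (\<alpha> k) < 1" and z: "z \<noteq> 0" "cmod z < 1"
    and s: "schur_value (left_params \<alpha> k) z s" and t: "schur_value (right_params \<alpha> k) z t"
begin

text \<open>Here \<Theta> maps (f(k - 1), f(k)) to the values of W f, which are S applied to source
  + z f. The sources (v, 0) and (0, w) give the two columns.\<close>

lemma cut_relation_odd:
  assumes "odd k"
  shows "cut_relation (\<alpha> k) z s t (green_block \<alpha> z (k - 1) (k - 1)) (green_block \<alpha> z (k - 1) k)
    (green_block \<alpha> z k (k - 1)) (green_block \<alpha> z k k)"
proof -
  let ?a = "\<alpha> k" and ?G = "green_block \<alpha> z"
  have eqs: "defect (conj_transpose ?a) *v (?G k (k - 1) *v v + ?G k k *v w)
        - ?a *v (?G (k - 1) (k - 1) *v v + ?G (k - 1) k *v w)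
      = s *v (v + z *s (?G (k - 1) (k - 1) *v v + ?G (k - 1) k *v w)) \<and>
      defect ?a *v (?G (k - 1) (k - 1) *v v + ?G (k - 1) k *v w)
        + conj_transpose ?a *v (?G k (k - 1) *v v + ?G k k *v w)
      = t *v (w + z *s (?G k (k - 1) *v v + ?G k k *v w))" for v w
  proof -
    define f where "f n = ?G n (k - 1) *v v + ?G n k *v w" for n
    note sol = green_cut_solution[of \<alpha>, OF contr z(2), of k v w, folded f_def[abs_def], folded f_def]
    obtain a b where "half_line (right_params \<alpha> k) z a b"
      "a 0 = block_op False \<alpha> f k" "b 0 = w + z *s f k"
      using half_lines_at_odd_cut(1)[of \<alpha>, OF contr z(1) sol assms] by blast
    then have t': "block_op False \<alpha> f k = t *v (w + z *s f k)"
      using schur_value_half_line[of "right_params \<alpha> k" z t a b] contr_params(1)[of \<alpha> k, OF contr] z(2) t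
      by simp
    obtain a b where "half_line (left_params \<alpha> k) z a b"
      "a 0 = block_op False \<alpha> f (k - 1)" "b 0 = v + z *s f (k - 1)"
      using half_lines_at_odd_cut(2)[of \<alpha>, OF contr z(1) sol assms] by blast
    then have s': "block_op False \<alpha> f (k - 1) = s *v (v + z *s f (k - 1))"
      using schur_value_half_line[of "left_params \<alpha> k" z s a b] contr_params(2)[of \<alpha> k, OF contr] z(2) s
      by simp
    show ?thesis
      using t' s' assms block_op_at_pair[of k False \<alpha> f] by (simp add: f_def)
  qed
  show ?thesis
    unfolding cut_relation_def matrix_eq
    using eqs[of _ 0] eqs[of 0]
    by (simp add: matrix_vector_mult_diff_rdistrib matrix_vector_mult_add_rdistrib mat_vector_mult
        matrix_vector_right_distrib vector_scalar_commute flip: matrix_vector_mul_assoc)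
qed

text \<open>Here \<Theta> H = source + z f and f = S H, so (\<Theta> - z S) H is the source. Thus G
  inverts \<Theta> - z S up to the factor S on its left, and G (\<Theta> - z S) = S, which is then
  transposed.\<close>

lemma cut_relation_even_transposed:
  assumes "even k"
  shows "cut_relation (transpose (\<alpha> k)) z (transpose s) (transpose t)
    (transpose (green_block \<alpha> z (k - 1) (k - 1))) (transpose (green_block \<alpha> z k (k - 1)))
    (transpose (green_block \<alpha> z (k - 1) k)) (transpose (green_block \<alpha> z k k))"
proof -
  let ?a = "\<alpha> k" and ?r = "defect (\<alpha> k)" and ?r' = "defect (conj_transpose (\<alpha> k))"
  let ?p = "green_block \<alpha> z (k - 1) (k - 1)" and ?h = "green_block \<alpha> z (k - 1) k"
    and ?q = "green_block \<alpha> z k (k - 1)" and ?g = "green_block \<alpha> z k k"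
  define X where "X v w = - (conj_transpose ?a *v (v + z *s (?p *v v + ?h *v w))) + ?r *v (w + z *s (?q *v v + ?g *v w))" for v w
  define Y where "Y v w = ?r' *v (v + z *s (?p *v v + ?h *v w)) + ?a *v (w + z *s (?q *v v + ?g *v w))" for v w
  have G: "?p *v v + ?h *v w = s *v X v w \<and> ?q *v v + ?g *v w = t *v Y v w" for v w
  proof -
    define f where "f n = green_block \<alpha> z n (k - 1) *v v + green_block \<alpha> z n k *v w" for n
    note sol = green_cut_solution[of \<alpha>, OF contr z(2), of k v w, folded f_def[abs_def], folded f_def]
    define H where "H = block_op False \<alpha> f"
    have K: "(if n = k - 1 then v else if n = k then w else 0) + z *s f n = block_op True \<alpha> H n" for n
      using fun_cong[OF cut_solution_factors(3)[of \<alpha>, OF contr z(1) sol], of n] by (simp add: H_def)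
    have "block_op True \<alpha> H (k - 1) = v + z *s f (k - 1)" "block_op True \<alpha> H k = w + z *s f k"
      using K[of "k - 1"] K[of k] by simp_all
    moreover have "H = block_inv True \<alpha> (block_op True \<alpha> H)"
      using contr by (simp add: block_inv_op)
    moreover have "even k = True" using assms by simp
    ultimately have H: "H (k - 1) = X v w" "H k = Y v w"
      using block_inv_at_pair[of k True \<alpha> "block_op True \<alpha> H"] by (simp_all add: X_def Y_def f_def)
    obtain a b where "half_line (right_params \<alpha> k) z a b" "a 0 = f k" "b 0 = H k"
      using half_lines_at_even_cut(1)[of \<alpha>, OF contr z(1) sol assms] unfolding H_def by blast
    then have "f k = t *v H k"
      using schur_value_half_line[of "right_params \<alpha> k" z t a b] contr_params(1)[of \<alpha> k, OF contr] z(2) t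
      by simp
    moreover
    obtain a b where "half_line (left_params \<alpha> k) z a b" "a 0 = f (k - 1)" "b 0 = H (k - 1)"
      using half_lines_at_even_cut(2)[of \<alpha>, OF contr z(1) sol assms] unfolding H_def by blast
    then have "f (k - 1) = s *v H (k - 1)"
      using schur_value_half_line[of "left_params \<alpha> k" z s a b] contr_params(2)[of \<alpha> k, OF contr] z(2) s
      by simp
    ultimately show ?thesis
      unfolding H by (simp add: f_def)
  qed
  define L where "L = (\<lambda>(x, y). (- (?a *v x) + ?r' *v y - z *s (s *v x), ?r *v x + conj_transpose ?a *v y - z *s (t *v y)))"
  define M where "M = (\<lambda>(v, w). (X v w, Y v w))"
  have smult: "z *s x = mat z *v x" for x :: "complex^'m"
    by (simp add: mat_vector_mult)
  have bl: "bounded_linear (\<lambda>x. A *v f x)" if "bounded_linear f"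
    for A :: "complex^'m^'m" and f :: "(complex^'m) \<times> (complex^'m) \<Rightarrow> complex^'m"
    using that by (rule bounded_linear_compose[OF matrix_vector_mul_bounded_linear])
  have "linear L" "linear M"
    unfolding L_def M_def X_def Y_def case_prod_unfold smult
    by (intro bounded_linear.linear bounded_linear_Pair bounded_linear_add bounded_linear_sub
        bounded_linear_minus bl bounded_linear_fst bounded_linear_snd)+
  moreover have "L \<circ> M = id"
  proof
    fix vw :: "(complex^'m) \<times> (complex^'m)"
    obtain v w where vw: "vw = (v, w)" by (cases vw)
    have "v + z *s (?p *v v + ?h *v w) = - (?a *v X v w) + ?r' *v Y v w \<and>
      w + z *s (?q *v v + ?g *v w) = ?r *v X v w + conj_transpose ?a *v Y v w"
      using theta_inverse_iff[OF contr[of k]] X_def Y_def by blast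
    then have "- (?a *v X v w) + ?r' *v Y v w = v + z *s (s *v X v w)"
      "?r *v X v w + conj_transpose ?a *v Y v w = w + z *s (t *v Y v w)"
      using G[of v w] by simp_all
    then show "(L \<circ> M) vw = id vw"
      by (simp only: vw L_def M_def o_apply case_prod_conv id_apply add_diff_cancel_right')
  qed
  \<comment> \<open>\<open>L\<close> is \<Theta> - z S and \<open>M\<close> maps the source to H. In
    finite dimension the one-sided inverse is two-sided, which permits arbitrary H as input.\<close>
  ultimately have M_L: "M \<circ> L = id"
    using linear_inverse_left by blast
  have eqs: "?p *v (- (?a *v x) + ?r' *v y - z *s (s *v x)) + ?h *v (?r *v x + conj_transpose ?a *v y - z *s (t *v y)) = s *v x
     \<and> ?q *v (- (?a *v x) + ?r' *v y - z *s (s *v x)) + ?g *v (?r *v x + conj_transpose ?a *v y - z *s (t *v y)) = t *v y" for x y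
    using G fun_cong[OF M_L, of "(x, y)"] by (simp add: L_def M_def)
  have "?h ** ?r - ?p ** ?a = s + mat z ** (?p ** s)"
    "?g ** ?r - ?q ** ?a = mat z ** (?q ** s)"
    "?p ** ?r' + ?h ** conj_transpose ?a = mat z ** (?h ** t)"
    "?q ** ?r' + ?g ** conj_transpose ?a = t + mat z ** (?g ** t)"
    unfolding matrix_eq
    using eqs[of _ 0] eqs[of 0]
    by (simp_all add: matrix_vector_mult_diff_rdistrib matrix_vector_mult_add_rdistrib mat_vector_mult
        matrix_vector_right_distrib matrix_vector_mult_diff_distrib vector_scalar_commute algebra_simps
        flip: matrix_vector_mul_assoc)
  from arg_cong[OF this(1), of transpose] arg_cong[OF this(2), of transpose]
    arg_cong[OF this(3), of transpose] arg_cong[OF this(4), of transpose]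
  have T: "transpose ?r ** transpose ?h - transpose ?a ** transpose ?p = transpose s + mat z ** (transpose s ** transpose ?p)"
    "transpose ?r ** transpose ?g - transpose ?a ** transpose ?q = mat z ** (transpose s ** transpose ?q)"
    "transpose ?r' ** transpose ?p + transpose (conj_transpose ?a) ** transpose ?h = mat z ** (transpose t ** transpose ?h)"
    "transpose ?r' ** transpose ?q + transpose (conj_transpose ?a) ** transpose ?g = transpose t + mat z ** (transpose t ** transpose ?g)"
    by (simp_all add: transpose_add transpose_diff matrix_transpose_mul mat_commute)
  have "transpose ?r' = defect (transpose ?a)"
    using transpose_defect[of "conj_transpose ?a"] contr[of k] by (simp add: conj_transpose_transpose)
  with T show ?thesis
    unfolding cut_relation_def transpose_defect[OF contr[of k]] by (simp add: conj_transpose_transpose)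
qed

end

section \<open>Uniqueness\<close>

text \<open>The second equation of the cut relation as z tends to 0: its right side is O(z) because
  \<open>s\<close> is a contraction. The constant collects |h0| + 1 from z s h(z) and 2 from each of
  the two data differences.\<close>

lemma cut_coefficient_equation:
  fixes a g0 h0 :: "complex^'m^'m"
  assumes a: "opnorm a < 1"
    and ev: "\<forall>\<^sub>F z in at 0. opnorm (g z - g0) \<le> 2 * cmod z \<and> opnorm (h z - h0) \<le> 2 * cmod z \<and>
      (\<exists>s t p q. opnorm s \<le> 1 \<and> cut_relation a z s t p (h z) q (g z))"
  shows "defect (conj_transpose a) ** g0 = a ** h0"
proof -
  let ?r' = "defect (conj_transpose a)"
  have small: "\<forall>\<^sub>F z in at (0::complex). z \<noteq> 0 \<and> cmod z < 1 / 2"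
    by (rule eventually_at_0_small) simp
  have "\<forall>\<^sub>F z in at 0. opnorm (?r' ** g0 - a ** h0) \<le> (opnorm h0 + 5) * cmod z"
    using ev small
  proof eventually_elim
    case (elim z)
    then obtain s t p q where s: "opnorm s \<le> 1" and cut: "cut_relation a z s t p (h z) q (g z)" by blast
    have "opnorm (h z) \<le> opnorm (h z - h0) + opnorm h0"
      using opnorm_add[of "h z - h0" h0] by simp
    then have h: "opnorm (h z) \<le> opnorm h0 + 1" using elim by simp
    have "?r' ** g z - a ** h z = mat z ** (s ** h z)"
      using cut by (simp add: cut_relation_def)
    then have eq: "?r' ** g0 - a ** h0 = mat z ** (s ** h z) - ?r' ** (g z - g0) + a ** (h z - h0)"
      by (simp add: matrix_diff_ldistrib algebra_simps)
    have "opnorm (mat z ** (s ** h z)) \<le> cmod z * (1 * (opnorm h0 + 1))"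
      by (intro opnorm_mult_le opnorm_mat s h)
    moreover have "opnorm (?r' ** (g z - g0)) \<le> 1 * (2 * cmod z)"
      using elim a by (intro opnorm_mult_le opnorm_defect_le) auto
    moreover have "opnorm (a ** (h z - h0)) \<le> 1 * (2 * cmod z)"
      using elim a by (intro opnorm_mult_le) auto
    moreover have "opnorm (?r' ** g0 - a ** h0) \<le> opnorm (mat z ** (s ** h z)) + opnorm (?r' ** (g z - g0)) + opnorm (a ** (h z - h0))"
      unfolding eq using opnorm_add[of "mat z ** (s ** h z) - ?r' ** (g z - g0)" "a ** (h z - h0)"]
        opnorm_diff[of "mat z ** (s ** h z)" "?r' ** (g z - g0)"] by linarith
    ultimately show ?case by (simp add: algebra_simps)
  qed
  then have "?r' ** g0 - a ** h0 = 0"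
    by (rule opnorm_eq_0_if_eventually_le)
  then show ?thesis by simp
qed

text \<open>With \<open>A = g\<^sub>0 h\<^sub>0\<^sup>-\<^sup>1\<close> one has \<open>a = \<rho> A\<close> and \<open>\<rho> (1 + A A\<^sup>*) \<rho> = \<rho>\<^sup>2 + a a\<^sup>* = 1\<close>, so that
  \<open>\<rho>\<^sup>2\<close>, and then \<open>a\<close>, is determined by \<open>A\<close>.\<close>

lemma coefficient_determined:
  fixes a b g0 h0 :: "complex^'m^'m"
  assumes a: "opnorm a < 1" and b: "opnorm b < 1" and h0: "invertible h0"
    and ea: "defect (conj_transpose a) ** g0 = a ** h0"
    and eb: "defect (conj_transpose b) ** g0 = b ** h0"
  shows "a = b"
proof -
  obtain h' where h': "h0 ** h' = mat 1" using h0 unfolding invertible_def by blast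
  define A where "A = g0 ** h'"
  define N where "N = mat 1 + A ** conj_transpose A"
  have *: "c = defect (conj_transpose c) ** A \<and>
      N ** (defect (conj_transpose c) ** defect (conj_transpose c)) = mat 1"
    if c: "opnorm c < 1" and ec: "defect (conj_transpose c) ** g0 = c ** h0" for c
  proof -
    let ?r = "defect (conj_transpose c)"
    have "?r ** A = (?r ** g0) ** h'" by (simp add: A_def matrix_mul_assoc)
    also have "\<dots> = c" by (simp add: ec h' flip: matrix_mul_assoc)
    finally have cA: "?r ** A = c" .
    have "conj_transpose c = conj_transpose A ** ?r"
      using arg_cong[OF cA, of conj_transpose] conj_transpose_defect[of "conj_transpose c"] c
      by (simp add: conj_transpose_mult)
    then have "c ** conj_transpose c = (?r ** A) ** (conj_transpose A ** ?r)"
      using cA by simp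
    then have "?r ** (N ** ?r) = ?r ** ?r + c ** conj_transpose c"
      by (simp add: N_def matrix_add_ldistrib matrix_add_rdistrib matrix_mul_assoc)
    also have "\<dots> = mat 1"
      using defect_conj_transpose_square[OF c] by simp
    finally have "(N ** ?r) ** ?r = mat 1"
      using matrix_left_right_inverse by blast
    then show ?thesis using cA by (simp add: matrix_mul_assoc)
  qed
  let ?ra = "defect (conj_transpose a)" and ?rb = "defect (conj_transpose b)"
  have "(?rb ** ?rb) ** N = mat 1"
    using *[OF b eb] matrix_left_right_inverse by blast
  then have "?ra ** ?ra = (?rb ** ?rb) ** (N ** (?ra ** ?ra))"
    by (simp only: matrix_mul_assoc[of "?rb ** ?rb"] matrix_mul_lid)
  then have "?ra ** ?ra = ?rb ** ?rb"
    using *[OF a ea] by simp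
  then have "mat 1 - a ** conj_transpose a = mat 1 - b ** conj_transpose b"
    using defect_conj_transpose_square[OF a] defect_conj_transpose_square[OF b] by simp
  \<comment> \<open>Both are roots of one and the same matrix, so they agree by definition.\<close>
  then have "?ra = ?rb"
    unfolding defect_def by simp
  then show ?thesis
    using *[OF a ea] *[OF b eb] by metis
qed

text \<open>The second equation fixes s h, since z can be cancelled, and \<open>h\<close> is close
  to the invertible \<open>h0\<close>. The fourth then fixes t (1 + z g), where z g is
  small.\<close>

lemma cut_relation_unique_column:
  fixes a h h0 g :: "complex^'m^'m"
  assumes cut: "cut_relation a z s t p h q g" "cut_relation a z s' t' p' h q' g"
    and z: "z \<noteq> 0" "cmod z < 1 / 2" and B: "h0 ** B = mat 1" "2 * cmod z * opnorm B < 1"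
    and h: "opnorm (h - h0) \<le> 2 * cmod z" and g: "opnorm g \<le> 2"
  shows "s = s'" "t = t'"
proof -
  have "mat z ** (s ** h) = mat z ** (s' ** h)"
    using cut unfolding cut_relation_def by metis
  then have "s ** h = s' ** h" using z(1) by (rule mat_mult_cancel)
  then have D: "(s - s') ** h = 0" by (simp add: matrix_diff_rdistrib)
  have "(s - s') ** (- (h - h0) ** B) = - ((s - s') ** h) ** B + (s - s') ** (h0 ** B)"
    by (simp add: matrix_diff_ldistrib matrix_diff_rdistrib matrix_mul_assoc)
  then have eq: "s - s' = (s - s') ** (- (h - h0) ** B)" using D B by simp
  have "opnorm (- (h - h0)) \<le> 2 * cmod z"
    using h by (simp only: opnorm_minus)
  then have "opnorm (- (h - h0) ** B) \<le> 2 * cmod z * opnorm B"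
    by (rule opnorm_mult_le) simp
  then have "opnorm ((s - s') ** (- (h - h0) ** B)) \<le> opnorm (s - s') * (2 * cmod z * opnorm B)"
    by (rule opnorm_mult_le[OF order_refl])
  then have "opnorm (s - s') \<le> (2 * cmod z * opnorm B) * opnorm (s - s')"
    using eq by (simp add: mult.commute)
  then have "s - s' = 0" using B(2) by (rule opnorm_self_bound_imp_0)
  then show "s = s'" by simp
  have "t + mat z ** (t ** g) = t' + mat z ** (t' ** g)"
    using cut unfolding cut_relation_def by metis
  then have "t - t' = mat z ** (t' ** g) - mat z ** (t ** g)"
    by (simp add: algebra_simps)
  also have "\<dots> = mat z ** ((t' - t) ** g)"
    by (simp add: matrix_diff_rdistrib matrix_diff_ldistrib)
  finally have eq: "t - t' = mat z ** ((t' - t) ** g)" .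
  have "opnorm (t' - t) = opnorm (t - t')"
    using opnorm_minus[of "t - t'"] by simp
  then have "opnorm (mat z ** ((t' - t) ** g)) \<le> cmod z * (opnorm (t - t') * 2)"
    using g by (intro opnorm_mult_le opnorm_mat) auto
  then have "opnorm (t - t') \<le> (2 * cmod z) * opnorm (t - t')"
    using eq by (simp add: mult_ac)
  then have "t - t' = 0" using z(2) by (intro opnorm_self_bound_imp_0) auto
  then show "t = t'" by simp
qed

text \<open>The diagonal equations bound the differences of \<open>s\<close> and \<open>t\<close> by
  those of \<open>q\<close> and \<open>h\<close>. The off-diagonal ones, after inversion of
  \<open>a\<close>, bound the latter by O(z) times all differences. Adding the two resulting bounds
  gives the factor 5 = 4 + 1.\<close>

lemma cut_relation_unique_diagonal:
  fixes a B :: "complex^'m^'m"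
  assumes cut: "cut_relation a z s t p h q g" "cut_relation a z s' t' p h' q' g"
    and a: "opnorm a < 1" and B: "B ** a = mat 1" "a ** B = mat 1"
    and z: "cmod z \<le> 1 / 4" "5 * opnorm B * cmod z < 1"
    and st: "opnorm s' \<le> 1" "opnorm t' \<le> 1"
    and G: "opnorm p \<le> 2" "opnorm h \<le> 2" "opnorm q \<le> 2" "opnorm g \<le> 2"
  shows "s = s'" "t = t'"
proof -
  \<comment> \<open>With |z| \<le> 1 / 4 and \<open>opnorm x \<le> 2\<close> the perturbation is at
    most half of \<open>opnorm D\<close>; moving it to the left gives the factor 2.\<close>
  have *: "opnorm D \<le> 2 * opnorm d"
    if eq: "r ** d = D + mat z ** (D ** x)" and "opnorm r \<le> 1" "opnorm x \<le> 2" for r d D x :: "complex^'m^'m"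
  proof -
    have "D = r ** d - mat z ** (D ** x)" using eq by simp
    then have "opnorm D \<le> opnorm (r ** d) + opnorm (mat z ** (D ** x))"
      using opnorm_diff by metis
    also have "\<dots> \<le> 1 * opnorm d + 1 / 4 * (opnorm D * 2)"
      using that z by (intro add_mono opnorm_mult_le order_trans[OF opnorm_mat]) auto
    finally show ?thesis by simp
  qed
  have **: "opnorm d \<le> opnorm B * cmod z * (2 * opnorm D + opnorm d)"
    if eq: "c ** d = mat z ** (D ** x + y ** d)" and C: "C ** c = mat 1" "opnorm C = opnorm B"
      and "opnorm x \<le> 2" "opnorm y \<le> 1" for c d D x y C :: "complex^'m^'m"
  proof -
    have "d = C ** (c ** d)" using C by (simp add: matrix_mul_assoc)
    then have "d = C ** (mat z ** (D ** x + y ** d))" using eq by simp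
    moreover have "opnorm (D ** x + y ** d) \<le> opnorm D * 2 + 1 * opnorm d"
      using that by (intro order_trans[OF opnorm_add] add_mono opnorm_mult_le) auto
    then have "opnorm (C ** (mat z ** (D ** x + y ** d))) \<le> opnorm B * (cmod z * (opnorm D * 2 + 1 * opnorm d))"
      using C(2) by (intro opnorm_mult_le opnorm_mat) auto
    ultimately have "opnorm d \<le> opnorm B * (cmod z * (opnorm D * 2 + 1 * opnorm d))" by metis
    then show ?thesis by (simp add: algebra_simps)
  qed
  let ?r = "defect a" and ?r' = "defect (conj_transpose a)"
  let ?d1 = "h - h'" and ?d2 = "q - q'"
  have "?r' ** q - a ** p = s + mat z ** (s ** p)" "?r' ** q' - a ** p = s' + mat z ** (s' ** p)"
    using cut by (simp_all add: cut_relation_def)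
  then have "(?r' ** q - a ** p) - (?r' ** q' - a ** p) = (s + mat z ** (s ** p)) - (s' + mat z ** (s' ** p))"
    by simp
  then have "?r' ** ?d2 = (s - s') + mat z ** ((s - s') ** p)"
    by (simp add: matrix_diff_ldistrib matrix_diff_rdistrib algebra_simps)
  then have e1: "opnorm (s - s') \<le> 2 * opnorm ?d2"
    by (rule *) (use a G in \<open>auto intro: opnorm_defect_le\<close>)
  have "?r ** h + conj_transpose a ** g = t + mat z ** (t ** g)"
    "?r ** h' + conj_transpose a ** g = t' + mat z ** (t' ** g)"
    using cut by (simp_all add: cut_relation_def)
  then have "(?r ** h + conj_transpose a ** g) - (?r ** h' + conj_transpose a ** g) = (t + mat z ** (t ** g)) - (t' + mat z ** (t' ** g))"
    by simp
  then have "?r ** ?d1 = (t - t') + mat z ** ((t - t') ** g)"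
    by (simp add: matrix_diff_ldistrib matrix_diff_rdistrib algebra_simps)
  then have e4: "opnorm (t - t') \<le> 2 * opnorm ?d1"
    by (rule *) (use a G in \<open>auto intro: opnorm_defect_le\<close>)
  have "?r' ** g - a ** h = mat z ** (s ** h)" "?r' ** g - a ** h' = mat z ** (s' ** h')"
    using cut by (simp_all add: cut_relation_def)
  then have "(?r' ** g - a ** h) - (?r' ** g - a ** h') = mat z ** (s ** h) - mat z ** (s' ** h')"
    by simp
  then have "(- a) ** ?d1 = mat z ** ((s - s') ** h + s' ** ?d1)"
    by (simp add: matrix_diff_ldistrib matrix_diff_rdistrib matrix_add_ldistrib algebra_simps)
  then have e2: "opnorm ?d1 \<le> opnorm B * cmod z * (2 * opnorm (s - s') + opnorm ?d1)"
    by (rule **[where C = "- B"]) (use B st G in simp_all)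
  have "?r ** p + conj_transpose a ** q = mat z ** (t ** q)" "?r ** p + conj_transpose a ** q' = mat z ** (t' ** q')"
    using cut by (simp_all add: cut_relation_def)
  then have "(?r ** p + conj_transpose a ** q) - (?r ** p + conj_transpose a ** q') = mat z ** (t ** q) - mat z ** (t' ** q')"
    by simp
  then have "conj_transpose a ** ?d2 = mat z ** ((t - t') ** q + t' ** ?d2)"
    by (simp add: matrix_diff_ldistrib matrix_diff_rdistrib matrix_add_ldistrib algebra_simps)
  then have e3: "opnorm ?d2 \<le> opnorm B * cmod z * (2 * opnorm (t - t') + opnorm ?d2)"
    by (rule **[where C = "conj_transpose B"]) (use B st G in \<open>simp_all flip: conj_transpose_mult\<close>)
  let ?c = "opnorm B * cmod z" and ?X = "opnorm ?d1 + opnorm ?d2"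
  have c0: "0 \<le> ?c" by simp
  have "opnorm ?d1 \<le> ?c * (4 * opnorm ?d2 + opnorm ?d1)"
    using e2 mult_left_mono[OF _ c0, of "2 * opnorm (s - s') + opnorm ?d1" "4 * opnorm ?d2 + opnorm ?d1"] e1 by linarith
  moreover have "opnorm ?d2 \<le> ?c * (4 * opnorm ?d1 + opnorm ?d2)"
    using e3 mult_left_mono[OF _ c0, of "2 * opnorm (t - t') + opnorm ?d2" "4 * opnorm ?d1 + opnorm ?d2"] e4 by linarith
  ultimately have "?X \<le> (5 * ?c) * ?X" by (simp add: algebra_simps)
  then have "(1 - 5 * ?c) * ?X \<le> 0" by (simp add: algebra_simps)
  moreover have "0 < 1 - 5 * ?c" using z(2) by (simp add: mult.assoc)
  ultimately have "?X \<le> 0" by (simp add: mult_le_0_iff)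
  then have "opnorm (s - s') \<le> 0" "opnorm (t - t') \<le> 0"
    using e1 e4 opnorm_nonneg[of ?d1] opnorm_nonneg[of ?d2] by linarith+
  then show "s = s'" "t = t'"
    using opnorm_le_0_imp by fastforce+
qed

text \<open>
  For even \<open>k\<close> the block relation holds with factors in the opposite order; transposing restores it.
\<close>

definition orient :: "int \<Rightarrow> complex^'m^'m \<Rightarrow> complex^'m^'m" where
  "orient k A = (if odd k then A else transpose A)"

lemma opnorm_orient [simp]: "opnorm (orient k A) = opnorm A"
  by (simp add: orient_def)

lemma orient_eq_iff [simp]: "orient k A = orient k B \<longleftrightarrow> A = B"
  by (simp add: orient_def)

lemma orient_diff: "orient k A - orient k B = orient k (A - B)"
  by (simp add: orient_def transpose_diff)

lemma invertible_orient [simp]: "invertible A \<Longrightarrow> invertible (orient k A)"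
proof -
  assume "invertible A"
  then obtain B where "A ** B = mat 1" "B ** A = mat 1"
    unfolding invertible_def by blast
  then have "transpose B ** transpose A = mat 1" "transpose A ** transpose B = mat 1"
    by (simp_all flip: matrix_transpose_mul)
  with \<open>invertible A\<close> show "invertible (orient k A)"
    unfolding orient_def invertible_def by auto
qed

text \<open>A common form for both parities. The entry \<open>q\<close> of G is in neither set of
  data, so only its bound is recorded.\<close>

lemma green_cut:
  fixes \<alpha> :: "int \<Rightarrow> complex^'m^'m"
  assumes contr: "\<And>k. opnorm (\<alpha> k) < 1" and z: "z \<noteq> 0" "cmod z < 1 / 2"
  shows "\<exists>s t q. schur_value (left_params \<alpha> k) z s \<and> schur_value (right_params \<alpha> k) z t \<and>
    opnorm s \<le> 1 \<and> opnorm t \<le> 1 \<and> opnorm q \<le> 2 \<and>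
    cut_relation (orient k (\<alpha> k)) z (orient k s) (orient k t) (orient k (green_g \<alpha> z (k - 1)))
      (orient k (green_h \<alpha> z k)) q (orient k (green_g \<alpha> z k))"
proof -
  have z1: "cmod z < 1" using z(2) by simp
  obtain s t where st: "schur_value (left_params \<alpha> k) z s" "schur_value (right_params \<alpha> k) z t"
    using schur_value_exists[of "left_params \<alpha> k" z] schur_value_exists[of "right_params \<alpha> k" z]
      contr_params[of \<alpha> k, OF contr] z by blast
  have "opnorm s \<le> 1" "opnorm t \<le> 1"
    using schur_value_opnorm[of "left_params \<alpha> k" z s] schur_value_opnorm[of "right_params \<alpha> k" z t]
      contr_params[of \<alpha> k, OF contr] z1 st by simp_all
  moreover define q where "q = (if odd k then green_block \<alpha> z k (k - 1) else transpose (green_block \<alpha> z (k - 1) k))"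
  moreover have "1 / (1 - cmod z) \<le> 2" using z(2) by (simp add: field_simps)
  then have "opnorm q \<le> 2"
    using opnorm_green_block[of \<alpha> z k "k - 1"] opnorm_green_block[of \<alpha> z "k - 1" k] contr z1
    by (auto simp: q_def)
  moreover have "cut_relation (orient k (\<alpha> k)) z (orient k s) (orient k t) (orient k (green_g \<alpha> z (k - 1)))
      (orient k (green_h \<alpha> z k)) q (orient k (green_g \<alpha> z k))"
    using cut_relation_odd[of \<alpha> z k s t, OF contr z(1) z1 st] cut_relation_even_transposed[of \<alpha> z k s t, OF contr z(1) z1 st]
    by (simp add: orient_def q_def green_g_def green_h_def)
  ultimately show ?thesis using st by blast
qed

lemma green_bounds:
  fixes \<alpha> :: "int \<Rightarrow> complex^'m^'m"
  assumes contr: "\<And>k. opnorm (\<alpha> k) < 1" and z: "cmod z < 1 / 2"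
  shows "opnorm (green_g \<alpha> z k) \<le> 2" "opnorm (green_h \<alpha> z k) \<le> 2"
    "opnorm (green_g \<alpha> z k - green_g \<alpha> 0 k) \<le> 2 * cmod z"
    "opnorm (green_h \<alpha> z k - green_h \<alpha> 0 k) \<le> 2 * cmod z"
proof -
  have z1: "cmod z < 1" using z by simp
  have le: "1 / (1 - cmod z) \<le> 2" using z by (simp add: field_simps)
  have "cmod z / (1 - cmod z) \<le> 2 * cmod z"
    using mult_left_mono[OF le, of "cmod z"] by simp
  then have "opnorm (green_block \<alpha> z i j) \<le> 2"
    "opnorm (green_block \<alpha> z i j - green_block \<alpha> 0 i j) \<le> 2 * cmod z" for i j
    using opnorm_green_block[of \<alpha> z i j] opnorm_green_block_diff[of \<alpha> z i j] contr z1 le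
    by (auto intro: order_trans)
  then show "opnorm (green_g \<alpha> z k) \<le> 2" "opnorm (green_h \<alpha> z k) \<le> 2"
    "opnorm (green_g \<alpha> z k - green_g \<alpha> 0 k) \<le> 2 * cmod z"
    "opnorm (green_h \<alpha> z k - green_h \<alpha> 0 k) \<le> 2 * cmod z"
    by (simp_all add: green_g_def green_h_def)
qed

section \<open>From the Green's data to the whole sequence\<close>

lemma verblunsky_eq_if_schur_values_eq:
  fixes \<alpha> \<beta> :: "int \<Rightarrow> complex^'m^'m"
  assumes contr: "\<And>k. opnorm (\<alpha> k) < 1" "\<And>k. opnorm (\<beta> k) < 1" and k: "\<alpha> k = \<beta> k"
    and ev: "\<forall>\<^sub>F z in at 0. \<exists>s t. schur_value (left_params \<alpha> k) z s \<and> schur_value (left_params \<beta> k) z s \<and>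
      schur_value (right_params \<alpha> k) z t \<and> schur_value (right_params \<beta> k) z t"
  shows "\<alpha> = \<beta>"
proof
  fix i
  have L: "left_params \<alpha> k n = left_params \<beta> k n" for n
    using contr by (intro schur_values_determine_parameters contr_params eventually_mono[OF ev]) auto
  have R: "right_params \<alpha> k n = right_params \<beta> k n" for n
    using contr by (intro schur_values_determine_parameters contr_params eventually_mono[OF ev]) auto
  consider "i = k" | "i < k" | "i > k" by linarith
  then show "\<alpha> i = \<beta> i"
  proof cases
    case 1
    then show ?thesis using k by simp
  next
    case 2
    then show ?thesis using L[of "nat (k - 1 - i)"] by (simp add: left_params_def)
  next
    case 3
    then show ?thesis using R[of "nat (i - k - 1)"] by (simp add: right_params_def)
  qed
qed

context
  fixes \<alpha> \<beta> :: "int \<Rightarrow> complex^'m^'m" and k :: int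
  assumes contr: "\<And>k. opnorm (\<alpha> k) < 1" "\<And>k. opnorm (\<beta> k) < 1"
begin

lemma verblunsky_determined_by_g_h:
  assumes inv: "invertible (green_h \<alpha> 0 k)"
    and ev: "\<forall>\<^sub>F z in nhds 0. green_g \<alpha> z k = green_g \<beta> z k \<and> green_h \<alpha> z k = green_h \<beta> z k"
  shows "\<alpha> = \<beta>"
proof -
  let ?o = "orient k"
  \<comment> \<open>\<open>g\<close> and \<open>h\<close> are built from \<alpha> and agree near 0
    with the data of \<beta>, so both coefficients satisfy one equation with the same
    \<open>g 0\<close> and \<open>h 0\<close>.\<close>
  define g where "g z = ?o (green_g \<alpha> z k)" for z
  define h where "h z = ?o (green_h \<alpha> z k)" for z
  have at: "\<forall>\<^sub>F z in at 0. green_g \<alpha> z k = green_g \<beta> z k \<and> green_h \<alpha> z k = green_h \<beta> z k"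
    using ev by (simp add: eventually_at_filter eventually_mono)
  have small: "\<forall>\<^sub>F z in at (0::complex). z \<noteq> 0 \<and> cmod z < 1 / 2"
    by (rule eventually_at_0_small) simp
  have lip: "opnorm (g z - g 0) \<le> 2 * cmod z" "opnorm (h z - h 0) \<le> 2 * cmod z" if "cmod z < 1 / 2" for z
    using green_bounds(3,4)[of \<alpha> z k] contr that by (simp_all add: g_def h_def orient_diff)
  have ea: "defect (conj_transpose (?o (\<alpha> k))) ** g 0 = ?o (\<alpha> k) ** h 0"
  proof (rule cut_coefficient_equation)
    show "\<forall>\<^sub>F z in at 0. opnorm (g z - g 0) \<le> 2 * cmod z \<and> opnorm (h z - h 0) \<le> 2 * cmod z \<and>
      (\<exists>s t p q. opnorm s \<le> 1 \<and> cut_relation (?o (\<alpha> k)) z s t p (h z) q (g z))"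
      using small
    proof eventually_elim
      case (elim z)
      obtain s t q where "opnorm s \<le> 1" "cut_relation (?o (\<alpha> k)) z (?o s) (?o t) (?o (green_g \<alpha> z (k - 1)))
          (?o (green_h \<alpha> z k)) q (?o (green_g \<alpha> z k))"
        using green_cut[of \<alpha> z k] contr elim by blast
      moreover have "opnorm (?o s) \<le> 1" using \<open>opnorm s \<le> 1\<close> by simp
      ultimately show ?case
        using lip elim unfolding g_def h_def by blast
    qed
  qed (use contr in simp)
  have eb: "defect (conj_transpose (?o (\<beta> k))) ** g 0 = ?o (\<beta> k) ** h 0"
  proof (rule cut_coefficient_equation)
    show "\<forall>\<^sub>F z in at 0. opnorm (g z - g 0) \<le> 2 * cmod z \<and> opnorm (h z - h 0) \<le> 2 * cmod z \<and>
      (\<exists>s t p q. opnorm s \<le> 1 \<and> cut_relation (?o (\<beta> k)) z s t p (h z) q (g z))"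
      using small at
    proof eventually_elim
      case (elim z)
      obtain s t q where "opnorm s \<le> 1" "cut_relation (?o (\<beta> k)) z (?o s) (?o t) (?o (green_g \<beta> z (k - 1)))
          (?o (green_h \<beta> z k)) q (?o (green_g \<beta> z k))"
        using green_cut[of \<beta> z k] contr elim by blast
      moreover have "opnorm (?o s) \<le> 1" using \<open>opnorm s \<le> 1\<close> by simp
      moreover have "g z = ?o (green_g \<beta> z k)" "h z = ?o (green_h \<beta> z k)"
        using elim by (simp_all add: g_def h_def)
      ultimately show ?case
        using lip elim by metis
    qed
  qed (use contr in simp)
  have invh: "invertible (h 0)"
    using inv by (simp add: h_def)
  have "?o (\<alpha> k) = ?o (\<beta> k)"
    by (rule coefficient_determined[OF _ _ invh ea eb]) (simp_all add: contr)
  then have k: "\<alpha> k = \<beta> k" by simp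
  obtain B where B: "h 0 ** B = mat 1"
    using invh unfolding invertible_def by blast
  \<comment> \<open>Adding 1 to \<open>opnorm B\<close> keeps the denominator positive and still
    gives \<open>2 * cmod z * opnorm B < 1\<close>.\<close>
  have small': "\<forall>\<^sub>F z in at (0::complex). z \<noteq> 0 \<and> cmod z < 1 / (2 * (opnorm B + 1))"
    by (rule eventually_at_0_small) (simp add: add_nonneg_pos)
  show ?thesis
  proof (rule verblunsky_eq_if_schur_values_eq[of \<alpha> \<beta> k, OF contr k])
    show "\<forall>\<^sub>F z in at 0. \<exists>s t. schur_value (left_params \<alpha> k) z s \<and> schur_value (left_params \<beta> k) z s \<and>
      schur_value (right_params \<alpha> k) z t \<and> schur_value (right_params \<beta> k) z t"
      using at small small'
    proof eventually_elim
      case (elim z)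
      have "0 < 2 * (opnorm B + 1)" by (simp add: add_nonneg_pos)
      then have "cmod z * (2 * (opnorm B + 1)) < 1"
        using elim by (simp only: pos_less_divide_eq)
      then have zB: "2 * cmod z * opnorm B < 1"
        using norm_ge_zero[of z] by (simp only: distrib_left mult_ac mult_1_right)
      obtain s t q where st: "schur_value (left_params \<alpha> k) z s" "schur_value (right_params \<alpha> k) z t"
        "cut_relation (?o (\<alpha> k)) z (?o s) (?o t) (?o (green_g \<alpha> z (k - 1))) (h z) q (g z)"
        using green_cut[of \<alpha> z k] contr elim unfolding g_def h_def by blast
      obtain s' t' q' where st': "schur_value (left_params \<beta> k) z s'" "schur_value (right_params \<beta> k) z t'"
        "cut_relation (?o (\<beta> k)) z (?o s') (?o t') (?o (green_g \<beta> z (k - 1))) (?o (green_h \<beta> z k)) q' (?o (green_g \<beta> z k))"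
        using green_cut[of \<beta> z k] contr elim by blast
      have gh: "?o (green_h \<beta> z k) = h z" "?o (green_g \<beta> z k) = g z" "?o (\<beta> k) = ?o (\<alpha> k)"
        using elim k by (simp_all add: g_def h_def)
      have "opnorm (h z - h 0) \<le> 2 * cmod z" "opnorm (g z) \<le> 2"
        using lip(2)[of z] green_bounds(1)[of \<alpha> z k] contr elim by (simp_all add: g_def)
      then have "?o s = ?o s'" "?o t = ?o t'"
        using cut_relation_unique_column[OF st(3) st'(3)[unfolded gh] _ _ B zB] elim by blast+
      then show ?case using st st' by auto
    qed
  qed
qed

lemma verblunsky_determined_by_diagonal:
  assumes inv: "invertible (\<alpha> k)" and k: "\<alpha> k = \<beta> k"
    and ev: "\<forall>\<^sub>F z in nhds 0. green_g \<alpha> z (k - 1) = green_g \<beta> z (k - 1) \<and> green_g \<alpha> z k = green_g \<beta> z k"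
  shows "\<alpha> = \<beta>"
proof (rule verblunsky_eq_if_schur_values_eq[of \<alpha> \<beta> k, OF contr k])
  let ?o = "orient k"
  have at: "\<forall>\<^sub>F z in at 0. green_g \<alpha> z (k - 1) = green_g \<beta> z (k - 1) \<and> green_g \<alpha> z k = green_g \<beta> z k"
    using ev by (simp add: eventually_at_filter eventually_mono)
  obtain B where B: "B ** ?o (\<alpha> k) = mat 1" "?o (\<alpha> k) ** B = mat 1"
    using invertible_orient[OF inv, of k] unfolding invertible_def by blast
  have small: "\<forall>\<^sub>F z in at (0::complex). z \<noteq> 0 \<and> cmod z < min (1 / 4) (1 / (5 * (opnorm B + 1)))"
    by (rule eventually_at_0_small) (simp add: add_nonneg_pos)
  show "\<forall>\<^sub>F z in at 0. \<exists>s t. schur_value (left_params \<alpha> k) z s \<and> schur_value (left_params \<beta> k) z s \<and>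
      schur_value (right_params \<alpha> k) z t \<and> schur_value (right_params \<beta> k) z t"
    using at small
  proof eventually_elim
    case (elim z)
    then have z: "z \<noteq> 0" "cmod z < 1 / 2" "cmod z \<le> 1 / 4" by auto
    have "0 < 5 * (opnorm B + 1)" by (simp add: add_nonneg_pos)
    then have "cmod z * (5 * (opnorm B + 1)) < 1"
      using elim by (simp only: pos_less_divide_eq min_less_iff_conj)
    then have zB: "5 * opnorm B * cmod z < 1"
      using norm_ge_zero[of z] by (simp only: distrib_left mult_ac mult_1_right)
    obtain s t q where st: "schur_value (left_params \<alpha> k) z s" "schur_value (right_params \<alpha> k) z t" "opnorm q \<le> 2"
      "cut_relation (?o (\<alpha> k)) z (?o s) (?o t) (?o (green_g \<alpha> z (k - 1))) (?o (green_h \<alpha> z k)) q (?o (green_g \<alpha> z k))"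
      using green_cut[of \<alpha> z k] contr z by blast
    obtain s' t' q' where st': "schur_value (left_params \<beta> k) z s'" "schur_value (right_params \<beta> k) z t'"
      "opnorm s' \<le> 1" "opnorm t' \<le> 1"
      "cut_relation (?o (\<beta> k)) z (?o s') (?o t') (?o (green_g \<beta> z (k - 1))) (?o (green_h \<beta> z k)) q' (?o (green_g \<beta> z k))"
      using green_cut[of \<beta> z k] contr z by blast
    have eqs: "green_g \<beta> z (k - 1) = green_g \<alpha> z (k - 1)" "green_g \<beta> z k = green_g \<alpha> z k" "\<beta> k = \<alpha> k"
      using elim k by simp_all
    have "?o s = ?o s' \<and> ?o t = ?o t'"
      using cut_relation_unique_diagonal[OF st(4) st'(5)[unfolded eqs] _ B z(3) zB]
        st(3) st'(3,4) contr green_bounds[of \<alpha> z] z by simp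
    then show ?case using st st' by auto
  qed
qed

end

theorem theorem1p3:
  fixes \<alpha> \<beta> :: "int \<Rightarrow> complex^'m^'m" and k0 :: int
  assumes "\<And>k. onorm ((*v) (\<alpha> k)) < 1"
    and "\<And>k. onorm ((*v) (\<beta> k)) < 1"
  shows
    "(invertible (green_h \<alpha> 0 k0) \<and> invertible (green_h \<beta> 0 k0) \<and>
      (\<forall>\<^sub>F z in nhds 0. green_g \<alpha> z k0 = green_g \<beta> z k0 \<and> green_h \<alpha> z k0 = green_h \<beta> z k0)
        \<longrightarrow> \<alpha> = \<beta> \<and> cmv_U \<alpha> = cmv_U \<beta>) \<and>
     (invertible (\<alpha> k0) \<and> invertible (\<beta> k0) \<and> \<alpha> k0 = \<beta> k0 \<and>
      (\<forall>\<^sub>F z in nhds 0. green_g \<alpha> z (k0 - 1) = green_g \<beta> z (k0 - 1) \<and>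
          green_g \<alpha> z k0 = green_g \<beta> z k0)
        \<longrightarrow> \<alpha> = \<beta> \<and> cmv_U \<alpha> = cmv_U \<beta>)"
  using verblunsky_determined_by_g_h[of \<alpha> \<beta> k0, OF assms]
    verblunsky_determined_by_diagonal[of \<alpha> \<beta> k0, OF assms] by blast

end
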